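(* Let $G$ be an eight-dimensional Lie group with Lie algebra $\mathfrak{g}$, equipped with a left-invariant Riemannian metric $g$, and let $K$ be a six-dimensional subgroup $\mathbf{SU}(2)\times\mathbf{SU}(2)$ of $G$ equipped with its standard Riemannian metric, with the orthonormal basis $\{A,B,C,R,S,T\}$ of its Lie algebra $\mathfrak{k}$ described in the context. Then, for a suitable orthonormal basis $\{X,Y\}$ of the orthogonal complement $\mathfrak{m}$ of $\mathfrak{k}$ in $\mathfrak{g}$, the Lie bracket relations of $\mathfrak{g}$ take the following form (the brackets $[U,V]$ with $U\in\{A,B,C\}$, $V\in\{R,S,T\}$ being zero): $$[A,B]=2C,\quad [C,A]=2B,\quad [B,C]=2A,\qquad [R,S]=2T,\quad [T,R]=2S,\quad [S,T]=2R,$$ $$[A,X]=-b_{11}B-c_{11}C,\quad [A,Y]=-b_{21}B-c_{21}C,$$ $$[B,X]=b_{11}A-c_{12}C,\quad [B,Y]=b_{21}A-c_{22}C,$$ $$[C,X]=c_{11}A+c_{12}B,\quad [C,Y]=c_{21}A+c_{22}B,$$ $$[R,X]=-s_{14}S-t_{14}T,\quad [R,Y]=-s_{24}S-t_{24}T,$$ $$[S,X]=s_{14}R-t_{15}T,\quad [S,Y]=s_{24}R-t_{25}T,$$ $$[T,X]=t_{14}R+t_{15}S,\quad [T,Y]=t_{24}R+t_{25}S,$$ $$[X,Y]=\rho X+\theta_1A+\theta_2B+\theta_3C+\theta_4R+\theta_5S+\theta_6T.$$ Here the 13 real coefficients $b_{11},b_{21},c_{11},c_{12},c_{21},c_{22},s_{14},s_{24},t_{14},t_{15},t_{24},t_{25},\rho$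 are arbitrary (i.e. every choice of them defines a Lie algebra by these relations) and $$\theta_1=\tfrac12(-\rho c_{12}+b_{11}c_{21}-b_{21}c_{11}),\quad \theta_2=\tfrac12(\rho c_{11}+b_{11}c_{22}-b_{21}c_{12}),\quad \theta_3=\tfrac12(-\rho b_{11}+c_{11}c_{22}-c_{12}c_{21}),$$ $$\theta_4=\tfrac12(-\rho t_{15}+s_{14}t_{24}-s_{24}t_{14}),\quad \theta_5=\tfrac12(\rho t_{14}+s_{14}t_{25}-s_{24}t_{15}),\quad \theta_6=\tfrac12(-\rho s_{14}+t_{14}t_{25}-t_{15}t_{24}).$$
   Context: The metric $g$ on $G$ is left-invariant and its restriction to $K=\mathbf{SU}(2)\times\mathbf{SU}(2)$ is the standard metric induced by the Killing form; concretely, $\mathfrak{k}=\mathfrak{su}(2)\times\mathfrak{su}(2)$ has a basis $\{A,B,C,R,S,T\}$, orthonormal with respect to $g$, such that $\{A,B,C\}$ spans the first copy of $\mathfrak{su}(2)$, $\{R,S,T\}$ spans the second, and $[A,B]=2C$, $[C,A]=2B$, $[B,C]=2A$, $[R,S]=2T$, $[T,R]=2S$, $[S,T]=2R$, with the two copies commuting. *)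

theory Defs
  imports
    "HOL-Analysis.Analysis"
    "HOL-Algebra.Group"
    "HOL-Library.Function_Algebras"
begin

section \<open>Pointwise vector space structure on function spaces\<close>

text \<open>Tangent vectors and vector fields are functions; this instance (on top of the pointwise
  addition of the library) makes \<^const>\<open>span\<close> applicable to them.\<close>

instantiation "fun" :: (type, real_vector) real_vector
begin

definition scaleR_fun :: "real \<Rightarrow> ('a \<Rightarrow> 'b) \<Rightarrow> 'a \<Rightarrow> 'b"
  where "scaleR_fun c f = (\<lambda>x. c *\<^sub>R f x)"

instance
  by standard (auto simp: scaleR_fun_def fun_eq_iff scaleR_add_right scaleR_add_left)

end


section \<open>Smooth maps between open subsets of Euclidean spaces\<close>

text \<open>For open \<open>S\<close> this is membership in the class \<open>C\<^sup>n\<close>.\<close>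

primrec Ck_on :: "nat \<Rightarrow> 'a::euclidean_space set \<Rightarrow> ('a \<Rightarrow> 'b::euclidean_space) \<Rightarrow> bool" where
  "Ck_on 0 S f \<longleftrightarrow> continuous_on S f"
| "Ck_on (Suc n) S f \<longleftrightarrow> f differentiable_on S \<and>
     (\<forall>v. Ck_on n S (\<lambda>x. frechet_derivative f (at x) v))"

definition smooth_on :: "'a::euclidean_space set \<Rightarrow> ('a \<Rightarrow> 'b::euclidean_space) \<Rightarrow> bool"
  where "smooth_on S f \<longleftrightarrow> (\<forall>n. Ck_on n S f)"


section \<open>Smooth manifolds and Lie groups\<close>

text \<open>A chart is a pair \<open>(U, \<phi>)\<close>; only the values of \<open>\<phi>\<close> on \<open>U\<close> matter. An atlas need not be
  maximal. The dimension of the manifold is \<open>DIM('a)\<close>.\<close>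

type_synonym ('g, 'a) chart = "'g set \<times> ('g \<Rightarrow> 'a)"

locale smooth_manifold =
  fixes At :: "('g::{t2_space, second_countable_topology}, 'a::euclidean_space) chart set"
  assumes chart_open: "(U, \<phi>) \<in> At \<Longrightarrow> open U \<and> open (\<phi> ` U)"
    and chart_homeo: "(U, \<phi>) \<in> At \<Longrightarrow> homeomorphism U (\<phi> ` U) \<phi> (inv_into U \<phi>)"
    and charts_cover: "\<exists>(U, \<phi>)\<in>At. p \<in> U"
    and charts_compat: "(U, \<phi>) \<in> At \<Longrightarrow> (V, \<psi>) \<in> At \<Longrightarrow>
      smooth_on (\<phi> ` (U \<inter> V)) (\<psi> \<circ> inv_into U \<phi>)"

text \<open>The underlying set of the group is a whole type, which carries the manifold topology.\<close>

locale lie_group = smooth_manifold At + group G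
  for G :: "'g::{t2_space, second_countable_topology} monoid"
    and At :: "('g, 'a::euclidean_space) chart set" +
  assumes carrier_UNIV: "carrier G = UNIV"
    and mult_continuous: "continuous_on UNIV (\<lambda>(x, y). x \<otimes>\<^bsub>G\<^esub> y)"
    and inv_continuous: "continuous_on UNIV (\<lambda>x. inv\<^bsub>G\<^esub> x)"
    and mult_smooth: "(U, \<phi>) \<in> At \<Longrightarrow> (V, \<psi>) \<in> At \<Longrightarrow> (W, \<omega>) \<in> At \<Longrightarrow>
      smooth_on {(\<phi> x, \<psi> y) | x y. x \<in> U \<and> y \<in> V \<and> x \<otimes>\<^bsub>G\<^esub> y \<in> W}
        (\<lambda>(a, b). \<omega> (inv_into U \<phi> a \<otimes>\<^bsub>G\<^esub> inv_into V \<psi> b))"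
    and inv_smooth: "(U, \<phi>) \<in> At \<Longrightarrow> (V, \<psi>) \<in> At \<Longrightarrow>
      smooth_on {\<phi> x | x. x \<in> U \<and> inv\<^bsub>G\<^esub> x \<in> V}
        (\<lambda>a. \<psi> (inv\<^bsub>G\<^esub> (inv_into U \<phi> a)))"


section \<open>Tangent vectors and vector fields\<close>

text \<open>Smoothness of a real function on a neighbourhood of a point.\<close>

definition smooth_near ::
    "('g::topological_space, 'a::euclidean_space) chart set \<Rightarrow> 'g \<Rightarrow> ('g \<Rightarrow> real) \<Rightarrow> bool"
  where "smooth_near At p f \<longleftrightarrow> (\<exists>W. open W \<and> p \<in> W \<and>
    (\<forall>(U, \<phi>)\<in>At. smooth_on (\<phi> ` (W \<inter> U)) (f \<circ> inv_into U \<phi>)))"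

text \<open>A tangent vector at \<open>p\<close> acts on the functions that are smooth near \<open>p\<close> as a directional
  derivative \<open>\<Sum>i. w\<^sub>i \<partial>/\<partial>x\<^sub>i\<close> in some chart around \<open>p\<close>. On all other functions it is
  put to \<open>0\<close>, so that tangent vectors with the same action are equal.\<close>

type_synonym 'g tangent_vector = "('g \<Rightarrow> real) \<Rightarrow> real"

definition tangent_space ::
    "('g::topological_space, 'a::euclidean_space) chart set \<Rightarrow> 'g \<Rightarrow> 'g tangent_vector set"
  where "tangent_space At p = {v. \<exists>(U, \<phi>)\<in>At. p \<in> U \<and> (\<exists>w.
    v = (\<lambda>f. if smooth_near At p f
              then frechet_derivative (f \<circ> inv_into U \<phi>) (at (\<phi> p)) w else 0))}"

type_synonym 'g vector_field = "'g \<Rightarrow> 'g tangent_vector"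

definition smooth_vector_field ::
    "('g::topological_space, 'a::euclidean_space) chart set \<Rightarrow> 'g vector_field \<Rightarrow> bool"
  where "smooth_vector_field At X \<longleftrightarrow> (\<forall>p. X p \<in> tangent_space At p) \<and>
    (\<forall>p f. smooth_near At p f \<longrightarrow> smooth_near At p (\<lambda>q. X q f))"

definition field_bracket ::
    "('g::topological_space, 'a::euclidean_space) chart set \<Rightarrow>
      'g vector_field \<Rightarrow> 'g vector_field \<Rightarrow> 'g vector_field"
  where "field_bracket At X Y = (\<lambda>p f. if smooth_near At p f
    then X p (\<lambda>q. Y q f) - Y p (\<lambda>q. X q f) else 0)"


section \<open>The Lie algebra of a Lie group and of a subgroup\<close>

text \<open>The differential of the left translation by \<open>a\<close>.\<close>

definition left_push :: "'g monoid \<Rightarrow> 'g \<Rightarrow> 'g tangent_vector \<Rightarrow> 'g tangent_vector"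
  where "left_push G a v = (\<lambda>f. v (\<lambda>q. f (a \<otimes>\<^bsub>G\<^esub> q)))"

definition lie_algebra ::
    "'g::topological_space monoid \<Rightarrow> ('g, 'a::euclidean_space) chart set \<Rightarrow> 'g vector_field set"
  where "lie_algebra G At = {X. smooth_vector_field At X \<and>
    (\<forall>a p. X (a \<otimes>\<^bsub>G\<^esub> p) = left_push G a (X p))}"

text \<open>The one-parameter subgroup \<open>t \<mapsto> exp (t X)\<close> with initial velocity \<open>X\<close>.\<close>

definition one_parameter_subgroup ::
    "'g::topological_space monoid \<Rightarrow> ('g, 'a::euclidean_space) chart set \<Rightarrow>
      'g vector_field \<Rightarrow> (real \<Rightarrow> 'g) \<Rightarrow> bool"
  where "one_parameter_subgroup G At X \<gamma> \<longleftrightarrow>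
    (\<forall>s t. \<gamma> (s + t) = \<gamma> s \<otimes>\<^bsub>G\<^esub> \<gamma> t) \<and>
    (\<forall>f. smooth_near At \<one>\<^bsub>G\<^esub> f \<longrightarrow>
      ((\<lambda>t. f (\<gamma> t)) has_real_derivative X \<one>\<^bsub>G\<^esub> f) (at 0))"

text \<open>The Lie algebra of a subgroup \<open>H\<close>, as a subset of the Lie algebra of the ambient group:
  the fields \<open>X\<close> with \<open>exp (t X) \<in> H\<close> for all \<open>t\<close>.\<close>

definition subgroup_lie_algebra ::
    "'g::topological_space monoid \<Rightarrow> ('g, 'a::euclidean_space) chart set \<Rightarrow> 'g set \<Rightarrow>
      'g vector_field set"
  where "subgroup_lie_algebra G At H = {X \<in> lie_algebra G At.
    \<exists>\<gamma>. one_parameter_subgroup G At X \<gamma> \<and> range \<gamma> \<subseteq> H}"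


section \<open>Left-invariant Riemannian metrics\<close>

definition riemannian_metric ::
    "('g::topological_space, 'a::euclidean_space) chart set \<Rightarrow>
      ('g \<Rightarrow> 'g tangent_vector \<Rightarrow> 'g tangent_vector \<Rightarrow> real) \<Rightarrow> bool"
  where "riemannian_metric At g \<longleftrightarrow>
    (\<forall>p. \<forall>u\<in>tangent_space At p. \<forall>v\<in>tangent_space At p. \<forall>w\<in>tangent_space At p. \<forall>c.
      g p (u + v) w = g p u w + g p v w \<and> g p (c *\<^sub>R u) w = c * g p u w \<and>
      g p u v = g p v u \<and> (u \<noteq> 0 \<longrightarrow> g p u u > 0)) \<and>
    (\<forall>X Y p. smooth_vector_field At X \<longrightarrow> smooth_vector_field At Y \<longrightarrow>
      smooth_near At p (\<lambda>q. g q (X q) (Y q)))"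

definition left_invariant_metric ::
    "'g::topological_space monoid \<Rightarrow> ('g, 'a::euclidean_space) chart set \<Rightarrow>
      ('g \<Rightarrow> 'g tangent_vector \<Rightarrow> 'g tangent_vector \<Rightarrow> real) \<Rightarrow> bool"
  where "left_invariant_metric G At g \<longleftrightarrow> riemannian_metric At g \<and>
    (\<forall>a p. \<forall>u\<in>tangent_space At p. \<forall>v\<in>tangent_space At p.
      g (a \<otimes>\<^bsub>G\<^esub> p) (left_push G a u) (left_push G a v) = g p u v)"

text \<open>On left-invariant fields a left-invariant metric is constant, so evaluation at the identity
  loses nothing.\<close>

definition metric_inner ::
    "'g monoid \<Rightarrow> ('g \<Rightarrow> 'g tangent_vector \<Rightarrow> 'g tangent_vector \<Rightarrow> real) \<Rightarrow>
      'g vector_field \<Rightarrow> 'g vector_field \<Rightarrow> real"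
  where "metric_inner G g X Y = g \<one>\<^bsub>G\<^esub> (X \<one>\<^bsub>G\<^esub>) (Y \<one>\<^bsub>G\<^esub>)"

definition orthonormal_basis ::
    "('v::real_vector \<Rightarrow> 'v \<Rightarrow> real) \<Rightarrow> 'v list \<Rightarrow> 'v set \<Rightarrow> bool"
  where "orthonormal_basis ip bs V \<longleftrightarrow> span (set bs) = V \<and>
    (\<forall>i<length bs. \<forall>j<length bs. ip (bs ! i) (bs ! j) = (if i = j then 1 else 0))"

definition orth_complement :: "('v \<Rightarrow> 'v \<Rightarrow> real) \<Rightarrow> 'v set \<Rightarrow> 'v set \<Rightarrow> 'v set"
  where "orth_complement ip V W = {z \<in> V. \<forall>u\<in>W. ip z u = 0}"


section \<open>Subgroups isomorphic to SU(2) x SU(2)\<close>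

definition SU2 :: "(complex^2^2) monoid"
  where "SU2 = \<lparr>carrier = {M. M ** (\<chi> i j. cnj (M $ j $ i)) = mat 1 \<and> det M = 1},
    monoid.mult = (**), one = mat 1\<rparr>"

text \<open>An isomorphism of topological groups from SU(2) x SU(2) onto the subgroup \<open>K\<close> of \<open>G\<close>. Such a
  \<open>K\<close> is compact, hence an embedded Lie subgroup, and since continuous homomorphisms of Lie groups
  are smooth, \<open>\<iota>\<close> is then an isomorphism of Lie groups.\<close>

definition SU2_SU2_subgroup ::
    "'g::topological_space monoid \<Rightarrow> 'g set \<Rightarrow> ((complex^2^2) \<times> (complex^2^2) \<Rightarrow> 'g) \<Rightarrow> bool"
  where "SU2_SU2_subgroup G K \<iota> \<longleftrightarrow> subgroup K G \<and>
    \<iota> \<in> iso (SU2 \<times>\<times> SU2) (G\<lparr>carrier := K\<rparr>) \<and>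
    (\<exists>\<kappa>. homeomorphism (carrier (SU2 \<times>\<times> SU2)) K \<iota> \<kappa>)"


section \<open>Bracket relations\<close>

definition lie_bracket :: "('v::real_vector \<Rightarrow> 'v \<Rightarrow> 'v) \<Rightarrow> bool"
  where "lie_bracket br \<longleftrightarrow> bilinear br \<and> (\<forall>x. br x x = 0) \<and>
    (\<forall>x y z. br x (br y z) + br y (br z x) + br z (br x y) = 0)"

definition su2_su2_relations ::
    "('v::real_vector \<Rightarrow> 'v \<Rightarrow> 'v) \<Rightarrow> 'v \<Rightarrow> 'v \<Rightarrow> 'v \<Rightarrow> 'v \<Rightarrow> 'v \<Rightarrow> 'v \<Rightarrow> bool"
  where "su2_su2_relations br A B C R S T \<longleftrightarrow>
    br A B = 2 *\<^sub>R C \<and> br C A = 2 *\<^sub>R B \<and> br B C = 2 *\<^sub>R A \<and>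
    br R S = 2 *\<^sub>R T \<and> br T R = 2 *\<^sub>R S \<and> br S T = 2 *\<^sub>R R \<and>
    (\<forall>U\<in>{A, B, C}. \<forall>V\<in>{R, S, T}. br U V = 0)"

definition bracket_relations ::
    "('v::real_vector \<Rightarrow> 'v \<Rightarrow> 'v) \<Rightarrow> 'v \<Rightarrow> 'v \<Rightarrow> 'v \<Rightarrow> 'v \<Rightarrow> 'v \<Rightarrow> 'v \<Rightarrow> 'v \<Rightarrow> 'v \<Rightarrow>
      real \<Rightarrow> real \<Rightarrow> real \<Rightarrow> real \<Rightarrow> real \<Rightarrow> real \<Rightarrow>
      real \<Rightarrow> real \<Rightarrow> real \<Rightarrow> real \<Rightarrow> real \<Rightarrow> real \<Rightarrow> real \<Rightarrow> bool"
  where "bracket_relations br A B C R S T X Y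
      b11 b21 c11 c12 c21 c22 s14 s24 t14 t15 t24 t25 \<rho> \<longleftrightarrow>
    su2_su2_relations br A B C R S T \<and>
    br A X = - b11 *\<^sub>R B - c11 *\<^sub>R C \<and> br A Y = - b21 *\<^sub>R B - c21 *\<^sub>R C \<and>
    br B X = b11 *\<^sub>R A - c12 *\<^sub>R C \<and> br B Y = b21 *\<^sub>R A - c22 *\<^sub>R C \<and>
    br C X = c11 *\<^sub>R A + c12 *\<^sub>R B \<and> br C Y = c21 *\<^sub>R A + c22 *\<^sub>R B \<and>
    br R X = - s14 *\<^sub>R S - t14 *\<^sub>R T \<and> br R Y = - s24 *\<^sub>R S - t24 *\<^sub>R T \<and>
    br S X = s14 *\<^sub>R R - t15 *\<^sub>R T \<and> br S Y = s24 *\<^sub>R R - t25 *\<^sub>R T \<and>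
    br T X = t14 *\<^sub>R R + t15 *\<^sub>R S \<and> br T Y = t24 *\<^sub>R R + t25 *\<^sub>R S \<and>
    br X Y = \<rho> *\<^sub>R X
      + (1/2 * (- \<rho> * c12 + b11 * c21 - b21 * c11)) *\<^sub>R A
      + (1/2 * (\<rho> * c11 + b11 * c22 - b21 * c12)) *\<^sub>R B
      + (1/2 * (- \<rho> * b11 + c11 * c22 - c12 * c21)) *\<^sub>R C
      + (1/2 * (- \<rho> * t15 + s14 * t24 - s24 * t14)) *\<^sub>R R
      + (1/2 * (\<rho> * t14 + s14 * t25 - s24 * t15)) *\<^sub>R S
      + (1/2 * (- \<rho> * s14 + t14 * t25 - t15 * t24)) *\<^sub>R T"

end

theory Submission
  imports Defs
begin

text \<open>Left-invariant fields correspond to their values at the identity, so the Lie algebra has dimension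
  eight. The action of each copy of \<open>su(2)\<close> on the two-dimensional quotient by \<open>k\<close> is trivial, because
  \<open>su(2)\<close> has no nontrivial real representation of dimension two; hence \<open>[k, m]\<close> lies in \<open>k\<close>. So \<open>X\<close> and
  \<open>Y\<close> act on \<open>k\<close> as derivations, which are skew-symmetric and preserve both copies; their entries are the
  first twelve coefficients. A rotation of \<open>m\<close> removes the \<open>Y\<close>-component of \<open>[X, Y]\<close>, and the Jacobi
  identity with an element of \<open>k\<close> then determines the \<open>k\<close>-component.\<close>

section \<open>Calculus of smooth maps\<close>

text \<open>The bracket of fields is bilinear only on smooth fields, and the metric is constrained
  only on tangent vectors. The Lie algebra is therefore pulled back to \<open>real^8\<close> by an
  isometry that takes the axes to \<open>A\<close>, ..., \<open>T\<close>, \<open>X\<close>,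
  \<open>Y\<close>. There coordinates 7 and 8 describe the quotient by \<open>k\<close>, and
  structural claims become comparisons of coordinates.

  The rotation works because it does not change \<open>[X, Y]\<close>: it is enough to turn
  \<open>X\<close> into the direction of the m-component of that bracket.

  Conversely, for arbitrary coefficients the Jacobi identity is not expanded on the relations. The
  derivations in question are inner, so \<open>X\<close> acts on the two copies like elements
  \<open>u\<close>, \<open>u'\<close> of them, and \<open>Y\<close> like \<open>w\<close>,
  \<open>w'\<close>. Subtracting these elements leaves the direct product of two copies of su(2) and
  the two-dimensional algebra with \<open>[X, Y] = \<rho> X\<close>. Seen from there, the first
  three theta coefficients form the vector \<open>2 u x w - \<rho> u\<close>, and the last three are
  \<open>2 u' x w' - \<rho> u'\<close>; the halves arise because \<open>u\<close> and
  \<open>w\<close> have halved coefficients as entries.\<close>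

abbreviation (input) "D f x \<equiv> frechet_derivative f (at x)"

lemma Ck_on_Suc_open:
  "open S \<Longrightarrow> Ck_on (Suc n) S f \<longleftrightarrow>
    (\<forall>x\<in>S. f differentiable (at x)) \<and> (\<forall>v. Ck_on n S (\<lambda>x. D f x v))"
  by (auto simp: differentiable_on_def at_within_open[of _ S])

lemma has_derivative_D: "f differentiable (at x) \<Longrightarrow> (f has_derivative D f x) (at x)"
  by (simp add: frechet_derivative_works)

lemma D_eqI: "(f has_derivative f') (at x) \<Longrightarrow> D f x = f'"
  by (metis frechet_derivative_at)

lemma D_cong:
  assumes "open S" "x \<in> S" "\<And>y. y \<in> S \<Longrightarrow> f y = g y" "f differentiable (at x)"
  shows "D g x = D f x"
  using frechet_derivative_transform_within_open[OF assms(4,1,2,3)] by simp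

lemma Ck_on_cong:
  assumes "open S" "\<And>x. x \<in> S \<Longrightarrow> f x = g x" "Ck_on n S f"
  shows "Ck_on n S g"
  using assms(2,3)
proof (induction n arbitrary: f g)
  case 0
  then show ?case by (simp cong: continuous_on_cong)
next
  case (Suc n)
  have df: "f differentiable (at x)" if "x \<in> S" for x
    using Suc.prems(2) that by (simp add: Ck_on_Suc_open[OF assms(1)] del: Ck_on.simps)
  have "g differentiable (at x)" if "x \<in> S" for x
    using has_derivative_transform_within_open[OF has_derivative_D[OF df[OF that]] assms(1) that Suc.prems(1)]
    by (auto simp: differentiable_def)
  moreover have "Ck_on n S (\<lambda>x. D g x v)" for v
  proof (rule Suc.IH)
    show "D f x v = D g x v" if "x \<in> S" for x
      using D_cong[OF assms(1) that Suc.prems(1) df[OF that]] by simp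
    show "Ck_on n S (\<lambda>x. D f x v)" using Suc.prems(2) by simp
  qed
  ultimately show ?case by (simp add: Ck_on_Suc_open[OF assms(1)] del: Ck_on.simps)
qed

lemma Ck_on_subset: "Ck_on n T f \<Longrightarrow> S \<subseteq> T \<Longrightarrow> Ck_on n S f"
  by (induction n arbitrary: f) (auto intro: continuous_on_subset differentiable_on_subset)

lemma Ck_on_local:
  assumes "open S" "\<And>x. x \<in> S \<Longrightarrow> \<exists>T. open T \<and> x \<in> T \<and> Ck_on n T f"
  shows "Ck_on n S f"
  using assms(2)
proof (induction n arbitrary: f)
  case 0
  then show ?case
    by (metis Ck_on.simps(1) assms(1) at_within_open continuous_on_eq_continuous_at)
next
  case (Suc n)
  have "f differentiable (at x)" if "x \<in> S" for x
    using Suc.prems[OF that] by (auto simp: Ck_on_Suc_open simp del: Ck_on.simps)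
  moreover have "Ck_on n S (\<lambda>x. D f x v)" for v
    by (rule Suc.IH) (use Suc.prems in fastforce)
  ultimately show ?case by (simp add: Ck_on_Suc_open[OF assms(1)] del: Ck_on.simps)
qed

text \<open>Lets a derivative \<open>F\<close> obtained from the usual rules stand in for the choice
  term \<open>frechet_derivative\<close>; on an open set the two agree at every point that
  matters.\<close>

lemma Ck_on_SucI:
  assumes "open S" "\<And>x. x \<in> S \<Longrightarrow> (f has_derivative F x) (at x)" "\<And>v. Ck_on n S (\<lambda>x. F x v)"
  shows "Ck_on (Suc n) S f"
proof -
  have "Ck_on n S (\<lambda>x. D f x v)" for v
    by (rule Ck_on_cong[OF assms(1) _ assms(3)[of v]]) (simp add: D_eqI[OF assms(2)])
  moreover have "\<forall>x\<in>S. f differentiable (at x)"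
    using assms(2) differentiableI by blast
  ultimately show ?thesis by (simp add: Ck_on_Suc_open[OF assms(1)] del: Ck_on.simps)
qed

lemma Ck_on_SucD: "Ck_on (Suc n) S f \<Longrightarrow> Ck_on n S f"
proof (induction n arbitrary: f)
  case 0
  then show ?case by (auto simp: differentiable_imp_continuous_on)
qed (metis Ck_on.simps(2))

lemma Ck_on_has_derivative:
  "open S \<Longrightarrow> Ck_on (Suc n) S f \<Longrightarrow> x \<in> S \<Longrightarrow> (f has_derivative D f x) (at x)"
  by (simp add: Ck_on_Suc_open has_derivative_D del: Ck_on.simps)

lemma Ck_on_D: "Ck_on (Suc n) S f \<Longrightarrow> Ck_on n S (\<lambda>x. D f x v)"
  by simp

lemma Ck_on_const: "Ck_on n S (\<lambda>x. c)"
proof (induction n arbitrary: c)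
  case (Suc n)
  then show ?case by (simp add: differentiable_on_def)
qed simp

lemma Ck_on_linear:
  assumes "bounded_linear h" "open S" shows "Ck_on n S h"
proof (cases n)
  case 0
  then show ?thesis using assms by (simp add: linear_continuous_on)
next
  case (Suc m)
  have "Ck_on (Suc m) S h"
    by (rule Ck_on_SucI[OF assms(2), of _ "\<lambda>x. h"])
      (auto intro: bounded_linear_imp_has_derivative[OF assms(1)] Ck_on_const)
  then show ?thesis using Suc by simp
qed

lemma Ck_on_add:
  "open S \<Longrightarrow> Ck_on n S f \<Longrightarrow> Ck_on n S g \<Longrightarrow> Ck_on n S (\<lambda>x. f x + g x)"
proof (induction n arbitrary: f g)
  case 0
  then show ?case by (auto intro: continuous_on_add)
next
  case (Suc n)
  show ?case
    by (rule Ck_on_SucI[OF Suc.prems(1), of _ "\<lambda>x v. D f x v + D g x v"])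
      (auto intro!: has_derivative_add Ck_on_has_derivative[OF Suc.prems(1)] Suc.IH Ck_on_D
        Suc.prems simp del: Ck_on.simps)
qed

lemma Ck_on_sum:
  "open S \<Longrightarrow> (\<And>i. i \<in> I \<Longrightarrow> Ck_on n S (f i)) \<Longrightarrow> Ck_on n S (\<lambda>x. \<Sum>i\<in>I. f i x)"
  by (induction I rule: infinite_finite_induct) (auto intro: Ck_on_const Ck_on_add)

lemma Ck_on_scaleR:
  "open S \<Longrightarrow> Ck_on n S f \<Longrightarrow> Ck_on n S g \<Longrightarrow> Ck_on n S (\<lambda>x. f x *\<^sub>R g x)"
proof (induction n arbitrary: f g)
  case 0
  then show ?case by (auto intro: continuous_on_scaleR)
next
  case (Suc n)
  show ?case
    by (rule Ck_on_SucI[OF Suc.prems(1), of _ "\<lambda>x v. f x *\<^sub>R D g x v + D f x v *\<^sub>R g x"])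
      (auto intro!: has_derivative_scaleR Ck_on_has_derivative[OF Suc.prems(1)] Suc.IH Ck_on_add Ck_on_D
        Suc.prems Ck_on_SucD[OF Suc.prems(2)] Ck_on_SucD[OF Suc.prems(3)] simp del: Ck_on.simps)
qed

lemma Ck_on_linear_compose:
  "bounded_linear h \<Longrightarrow> open S \<Longrightarrow> Ck_on n S f \<Longrightarrow> Ck_on n S (\<lambda>x. h (f x))"
proof (induction n arbitrary: f)
  case 0
  then show ?case by (auto intro: bounded_linear.continuous_on)
next
  case (Suc n)
  show ?case
    by (rule Ck_on_SucI[OF Suc.prems(2), of _ "\<lambda>x v. h (D f x v)"])
      (auto intro!: bounded_linear.has_derivative[OF Suc.prems(1)]
        Ck_on_has_derivative[OF Suc.prems(2)] Suc.IH Ck_on_D Suc.prems simp del: Ck_on.simps)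
qed

lemma linear_eq_sum_Basis:
  fixes h :: "'a::euclidean_space \<Rightarrow> 'b::real_vector"
  assumes "linear h"
  shows "h v = (\<Sum>i\<in>Basis. (v \<bullet> i) *\<^sub>R h i)"
  using assms
  by (metis (mono_tags, lifting) euclidean_representation linear_sum linear_scale sum.cong)

lemma Ck_on_compose:
  fixes f :: "'b::euclidean_space \<Rightarrow> 'c::euclidean_space" and h :: "'a::euclidean_space \<Rightarrow> 'b"
  assumes "open S" "open T" "h ` S \<subseteq> T" "Ck_on n S h" "Ck_on n T f"
  shows "Ck_on n S (\<lambda>x. f (h x))"
  using assms(4,5)
proof (induction n arbitrary: f)
  case 0
  then show ?case using assms(3) by (auto intro: continuous_on_compose2)
next
  case (Suc n)
  show ?case
  proof (rule Ck_on_SucI[OF assms(1), of _ "\<lambda>x v. D f (h x) (D h x v)"])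
    fix x assume x: "x \<in> S"
    show "((\<lambda>x. f (h x)) has_derivative (\<lambda>v. D f (h x) (D h x v))) (at x)"
      by (rule has_derivative_compose[OF Ck_on_has_derivative[OF assms(1) Suc.prems(1) x]
          Ck_on_has_derivative[OF assms(2) Suc.prems(2)]]) (use assms(3) x in auto)
  next
    fix v
    \<comment> \<open>\<open>Ck_on\<close> controls derivatives in a fixed direction only, but the
      direction \<open>D h x v\<close> moves with \<open>x\<close>. Expansion in the basis leaves
      fixed directions with varying coefficients.\<close>
    have "Ck_on n S (\<lambda>x. \<Sum>i\<in>Basis. (D h x v \<bullet> i) *\<^sub>R D f (h x) i)"
      by (intro Ck_on_sum Ck_on_scaleR assms(1) Suc.IH Ck_on_SucD[OF Suc.prems(1)]
          Ck_on_D[OF Suc.prems(2)]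
          Ck_on_linear_compose[OF bounded_linear_inner_left] Ck_on_D[OF Suc.prems(1)])
    moreover have "(\<Sum>i\<in>Basis. (D h x v \<bullet> i) *\<^sub>R D f (h x) i) = D f (h x) (D h x v)"
      if "x \<in> S" for x
    proof -
      have "linear (D f (h x))"
        using Ck_on_has_derivative[OF assms(2) Suc.prems(2), of "h x"] assms(3) that
        by (auto intro: has_derivative_linear)
      then show ?thesis using linear_eq_sum_Basis by metis
    qed
    ultimately show "Ck_on n S (\<lambda>x. D f (h x) (D h x v))"
      by (rule Ck_on_cong[OF assms(1), rotated])
  qed
qed

lemma smooth_on_subset: "smooth_on T f \<Longrightarrow> S \<subseteq> T \<Longrightarrow> smooth_on S f"
  unfolding smooth_on_def using Ck_on_subset by blast

lemma smooth_on_cong: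
  "open S \<Longrightarrow> (\<And>x. x \<in> S \<Longrightarrow> f x = g x) \<Longrightarrow> smooth_on S f \<Longrightarrow> smooth_on S g"
  unfolding smooth_on_def using Ck_on_cong by blast

lemma smooth_on_local:
  "open S \<Longrightarrow> (\<And>x. x \<in> S \<Longrightarrow> \<exists>T. open T \<and> x \<in> T \<and> smooth_on T f) \<Longrightarrow> smooth_on S f"
  unfolding smooth_on_def by (intro allI Ck_on_local) auto

lemma smooth_on_const: "smooth_on S (\<lambda>x. c)"
  by (simp add: smooth_on_def Ck_on_const)

lemma smooth_on_linear: "bounded_linear h \<Longrightarrow> open S \<Longrightarrow> smooth_on S h"
  by (simp add: smooth_on_def Ck_on_linear)

lemma smooth_on_linear_compose:
  "bounded_linear h \<Longrightarrow> open S \<Longrightarrow> smooth_on S f \<Longrightarrow> smooth_on S (\<lambda>x. h (f x))"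
  by (simp add: smooth_on_def Ck_on_linear_compose)

lemma smooth_on_add:
  "open S \<Longrightarrow> smooth_on S f \<Longrightarrow> smooth_on S g \<Longrightarrow> smooth_on S (\<lambda>x. f x + g x)"
  by (simp add: smooth_on_def Ck_on_add)

lemma smooth_on_sum:
  "open S \<Longrightarrow> (\<And>i. i \<in> I \<Longrightarrow> smooth_on S (f i)) \<Longrightarrow> smooth_on S (\<lambda>x. \<Sum>i\<in>I. f i x)"
  by (simp add: smooth_on_def Ck_on_sum)

lemma smooth_on_scaleR:
  "open S \<Longrightarrow> smooth_on S f \<Longrightarrow> smooth_on S g \<Longrightarrow> smooth_on S (\<lambda>x. f x *\<^sub>R g x)"
  by (simp add: smooth_on_def Ck_on_scaleR)

lemma smooth_on_compose:
  assumes "open S" "open T" "h ` S \<subseteq> T" "smooth_on S h" "smooth_on T f"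
  shows "smooth_on S (\<lambda>x. f (h x))"
  using assms Ck_on_compose by (fastforce simp: smooth_on_def)

lemma smooth_on_D: "smooth_on S f \<Longrightarrow> smooth_on S (\<lambda>x. D f x v)"
  unfolding smooth_on_def using Ck_on_D by blast

lemma smooth_on_has_derivative:
  "open S \<Longrightarrow> smooth_on S f \<Longrightarrow> x \<in> S \<Longrightarrow> (f has_derivative D f x) (at x)"
  unfolding smooth_on_def using Ck_on_has_derivative by blast

lemma smooth_on_linear_D: "open S \<Longrightarrow> smooth_on S f \<Longrightarrow> x \<in> S \<Longrightarrow> linear (D f x)"
  using smooth_on_has_derivative has_derivative_linear by blast

lemma smooth_on_continuous: "smooth_on S f \<Longrightarrow> continuous_on S f"
  by (metis Ck_on.simps(1) smooth_on_def)

lemma smooth_on_D_field: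
  assumes "open S" "smooth_on S f" "smooth_on S w"
  shows "smooth_on S (\<lambda>x. D f x (w x))"
proof -
  have "smooth_on S (\<lambda>x. \<Sum>i\<in>Basis. (w x \<bullet> i) *\<^sub>R D f x i)"
    by (intro smooth_on_sum smooth_on_scaleR smooth_on_D assms
        smooth_on_linear_compose[OF bounded_linear_inner_left])
  then show ?thesis
    by (rule smooth_on_cong[OF assms(1), rotated])
      (rule linear_eq_sum_Basis[symmetric], rule smooth_on_linear_D[OF assms(1,2)])
qed

section \<open>Symmetry of second derivatives\<close>

text \<open>The mean value theorem is applied twice: to the difference of \<open>f\<close> along two
  parallel sides in direction \<open>u\<close>, then to the derivative in direction
  \<open>v\<close>. The bound on \<open>s\<close> keeps the whole parallelogram inside the ball. The
  left-hand side is symmetric in \<open>u\<close> and \<open>v\<close>, which is the point of the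
  lemma.\<close>

lemma second_difference_mean_value:
  fixes f :: "'a::real_normed_vector \<Rightarrow> real"
  assumes f: "\<And>x. x \<in> ball a r \<Longrightarrow> (f has_derivative f' x) (at x)"
    and g: "\<And>x. x \<in> ball a r \<Longrightarrow> ((\<lambda>x. f' x u) has_derivative g x) (at x)"
    and s: "0 < s" "s * (norm u + norm v) < r"
  shows "\<exists>x\<in>ball a r. f (a + s *\<^sub>R u + s *\<^sub>R v) - f (a + s *\<^sub>R u) - f (a + s *\<^sub>R v) + f a = s\<^sup>2 * g x v"
proof -
  have inb: "a + p *\<^sub>R u + q *\<^sub>R v \<in> ball a r" if "0 \<le> p" "p \<le> s" "0 \<le> q" "q \<le> s" for p q
  proof -
    have "norm (p *\<^sub>R u + q *\<^sub>R v) \<le> p * norm u + q * norm v"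
      using norm_triangle_ineq[of "p *\<^sub>R u" "q *\<^sub>R v"] that by simp
    also have "\<dots> \<le> s * norm u + s * norm v"
      using that by (intro add_mono mult_right_mono) auto
    also have "\<dots> < r" using s by (simp add: algebra_simps)
    finally have "norm (a - (a + p *\<^sub>R u + q *\<^sub>R v)) < r"
      by (metis add.assoc add_diff_cancel_left' norm_minus_commute)
    then show ?thesis by (simp add: dist_norm)
  qed
  have d: "((\<lambda>p. f (a + p *\<^sub>R u + q *\<^sub>R v)) has_real_derivative f' (a + p *\<^sub>R u + q *\<^sub>R v) u) (at p)"
    if "0 \<le> p" "p \<le> s" "0 \<le> q" "q \<le> s" for p q
  proof -
    have "((\<lambda>p. f (a + p *\<^sub>R u + q *\<^sub>R v)) has_derivative (\<lambda>h. f' (a + p *\<^sub>R u + q *\<^sub>R v) (h *\<^sub>R u))) (at p)"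
      by (rule has_derivative_compose[of "\<lambda>p. a + p *\<^sub>R u + q *\<^sub>R v" "\<lambda>h. h *\<^sub>R u" p UNIV f,
            OF _ f[OF inb[OF that]]]) (auto intro!: derivative_eq_intros)
    moreover have "linear (f' (a + p *\<^sub>R u + q *\<^sub>R v))"
      using f[OF inb[OF that]] has_derivative_linear by blast
    ultimately show ?thesis
      by (simp add: has_field_derivative_def linear_scale mult.commute[of _ "f' _ u"])
  qed
  have "\<exists>p. 0 < p \<and> p < s \<and>
      (f (a + s *\<^sub>R u + s *\<^sub>R v) - f (a + s *\<^sub>R u + 0 *\<^sub>R v)) - (f (a + 0 *\<^sub>R u + s *\<^sub>R v) - f (a + 0 *\<^sub>R u + 0 *\<^sub>R v)) =
      (s - 0) * (f' (a + p *\<^sub>R u + s *\<^sub>R v) u - f' (a + p *\<^sub>R u + 0 *\<^sub>R v) u)"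
    using s(1) by (intro MVT2) (auto intro!: DERIV_diff d simp del: scaleR_zero_left)
  then obtain p where p: "0 < p" "p < s" and 1:
      "f (a + s *\<^sub>R u + s *\<^sub>R v) - f (a + s *\<^sub>R u) - (f (a + s *\<^sub>R v) - f a) =
      s * (f' (a + p *\<^sub>R u + s *\<^sub>R v) u - f' (a + p *\<^sub>R u) u)" by auto
  have d2: "((\<lambda>q. f' (a + p *\<^sub>R u + q *\<^sub>R v) u) has_real_derivative g (a + p *\<^sub>R u + q *\<^sub>R v) v) (at q)"
    if "0 \<le> q" "q \<le> s" for q
  proof -
    have i: "a + p *\<^sub>R u + q *\<^sub>R v \<in> ball a r" using inb that p by simp
    have "((\<lambda>q. f' (a + p *\<^sub>R u + q *\<^sub>R v) u) has_derivative (\<lambda>h. g (a + p *\<^sub>R u + q *\<^sub>R v) (h *\<^sub>R v))) (at q)"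
      by (rule has_derivative_compose[of "\<lambda>q. a + p *\<^sub>R u + q *\<^sub>R v" "\<lambda>h. h *\<^sub>R v" q UNIV
            "\<lambda>x. f' x u", OF _ g[OF i]]) (auto intro!: derivative_eq_intros)
    moreover have "linear (g (a + p *\<^sub>R u + q *\<^sub>R v))"
      using g[OF i] has_derivative_linear by blast
    ultimately show ?thesis
      by (simp add: has_field_derivative_def linear_scale mult.commute[of _ "g _ v"])
  qed
  have "\<exists>q. 0 < q \<and> q < s \<and>
      f' (a + p *\<^sub>R u + s *\<^sub>R v) u - f' (a + p *\<^sub>R u + 0 *\<^sub>R v) u =
      (s - 0) * g (a + p *\<^sub>R u + q *\<^sub>R v) v"
    using s(1) by (intro MVT2) (auto intro!: d2)
  then obtain q where q: "0 < q" "q < s" and 2: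
      "f' (a + p *\<^sub>R u + s *\<^sub>R v) u - f' (a + p *\<^sub>R u) u = s * g (a + p *\<^sub>R u + q *\<^sub>R v) v" by auto
  have "f (a + s *\<^sub>R u + s *\<^sub>R v) - f (a + s *\<^sub>R u) - f (a + s *\<^sub>R v) + f a = s\<^sup>2 * g (a + p *\<^sub>R u + q *\<^sub>R v) v"
    using 1 2 by (simp add: power2_eq_square algebra_simps)
  then show ?thesis using inb p q by (intro bexI[of _ "a + p *\<^sub>R u + q *\<^sub>R v"]) auto
qed

text \<open>The second difference is symmetric in \<open>u\<close> and \<open>v\<close>, so the two
  mixed derivatives agree at some pair of points near \<open>a\<close>; continuity forbids this if
  they differ at \<open>a\<close>.\<close>

lemma smooth_on_second_derivative_symmetric:
  fixes f :: "'a::euclidean_space \<Rightarrow> real"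
  assumes "open S" "smooth_on S f" "a \<in> S"
  shows "D (\<lambda>x. D f x u) a v = D (\<lambda>x. D f x v) a u"
proof (rule ccontr)
  let ?g = "\<lambda>u v x. D (\<lambda>x. D f x u) x v"
  assume neq: "\<not> ?thesis"
  \<comment> \<open>Half the gap: two deviations that are each below \<open>e\<close> cannot close
    it.\<close>
  define e where "e = \<bar>?g u v a - ?g v u a\<bar> / 2"
  have e: "e > 0" using neq by (simp add: e_def)
  have c: "continuous_on S (?g u v)" for u v
    by (intro smooth_on_continuous smooth_on_D assms)
  have near: "\<exists>d>0. ball a d \<subseteq> S \<and> (\<forall>x\<in>ball a d. \<bar>?g u v x - ?g u v a\<bar> < e)" for u v
  proof -
    obtain d1 where d1: "d1 > 0" "ball a d1 \<subseteq> S"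
      using assms(1,3) openE by blast
    obtain d2 where d2: "d2 > 0" "\<And>x. x \<in> S \<Longrightarrow> dist x a < d2 \<Longrightarrow> dist (?g u v x) (?g u v a) < e"
      using c[of u v] assms(3) e unfolding continuous_on_iff by metis
    show ?thesis using d1 d2
      by (intro exI[of _ "min d1 d2"]) (auto simp: dist_real_def dist_commute subset_eq)
  qed
  obtain d1 where d1: "d1 > 0" "ball a d1 \<subseteq> S" "\<And>x. x \<in> ball a d1 \<Longrightarrow> \<bar>?g u v x - ?g u v a\<bar> < e"
    using near by metis
  obtain d2 where d2: "d2 > 0" "ball a d2 \<subseteq> S" "\<And>x. x \<in> ball a d2 \<Longrightarrow> \<bar>?g v u x - ?g v u a\<bar> < e"
    using near by metis
  define d where "d = min d1 d2"
  \<comment> \<open>Small enough for the parallelogram to fit into the ball of radius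
    \<open>d\<close>; the \<open>+ 1\<close> keeps the denominator positive.\<close>
  define s where "s = d / (2 * (norm u + norm v + 1))"
  have d: "d > 0" using d1 d2 by (simp add: d_def)
  have pos: "0 < norm u + norm v + 1" by (simp add: add_nonneg_pos)
  have s: "s > 0" using d pos by (simp add: s_def)
  have "s * (norm u + norm v) < s * (2 * (norm u + norm v + 1))"
    using s by (intro mult_strict_left_mono) (smt (verit) norm_ge_zero)+
  also have "\<dots> = d" using pos by (simp add: s_def)
  finally have sd: "s * (norm u + norm v) < d" .
  have S: "x \<in> S" if "x \<in> ball a d" for x using that d1(2) by (auto simp: d_def)
  have fd: "(f has_derivative D f x) (at x)" if "x \<in> ball a d" for x
    using smooth_on_has_derivative[OF assms(1,2) S[OF that]] .
  have gd: "((\<lambda>x. D f x w) has_derivative D (\<lambda>x. D f x w) x) (at x)" if "x \<in> ball a d" for x w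
    using smooth_on_has_derivative[OF assms(1) smooth_on_D[OF assms(2)] S[OF that]] .
  obtain x where x: "x \<in> ball a d"
    "f (a + s *\<^sub>R u + s *\<^sub>R v) - f (a + s *\<^sub>R u) - f (a + s *\<^sub>R v) + f a = s\<^sup>2 * ?g u v x"
    using second_difference_mean_value[OF fd gd s sd] by blast
  have sd': "s * (norm v + norm u) < d" using sd by (simp add: add.commute)
  obtain y where y: "y \<in> ball a d"
    "f (a + s *\<^sub>R v + s *\<^sub>R u) - f (a + s *\<^sub>R v) - f (a + s *\<^sub>R u) + f a = s\<^sup>2 * ?g v u y"
    using second_difference_mean_value[OF fd gd s sd'] by blast
  have "s\<^sup>2 * ?g u v x = s\<^sup>2 * ?g v u y"
    using x(2) y(2) by (simp add: algebra_simps)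
  then have "?g u v x = ?g v u y" using s by simp
  moreover have "\<bar>?g u v x - ?g u v a\<bar> < e" "\<bar>?g v u y - ?g v u a\<bar> < e"
    using x(1) y(1) d1(3) d2(3) by (auto simp: d_def)
  ultimately show False by (simp add: e_def abs_if split: if_splits)
qed

section \<open>Vector fields in charts\<close>

text \<open>The functional from the definition of \<open>tangent_space\<close>, with the chart made
  explicit: for a fixed chart around \<open>p\<close> it is a linear isomorphism from the model
  space onto the tangent space.\<close>

definition chart_vector ::
    "('g::topological_space, 'a::euclidean_space) chart set \<Rightarrow> 'g set \<Rightarrow> ('g \<Rightarrow> 'a) \<Rightarrow> 'g \<Rightarrow> 'a \<Rightarrow>
      'g tangent_vector"
  where "chart_vector At U \<phi> p w =
    (\<lambda>f. if smooth_near At p f then D (f \<circ> inv_into U \<phi>) (\<phi> p) w else 0)"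

lemma chart_vector_in_tangent_space:
  "(U, \<phi>) \<in> At \<Longrightarrow> p \<in> U \<Longrightarrow> chart_vector At U \<phi> p w \<in> tangent_space At p"
  by (auto simp: tangent_space_def chart_vector_def)

context smooth_manifold
begin

lemma chart_inv: "(U, \<phi>) \<in> At \<Longrightarrow> x \<in> U \<Longrightarrow> inv_into U \<phi> (\<phi> x) = x"
  by (meson chart_homeo homeomorphism_apply1)

lemma chart_inv': "(U, \<phi>) \<in> At \<Longrightarrow> b \<in> \<phi> ` U \<Longrightarrow> \<phi> (inv_into U \<phi> b) = b"
  by (simp add: f_inv_into_f)

lemma chart_inv_in: "b \<in> \<phi> ` U \<Longrightarrow> inv_into U \<phi> b \<in> U"
  by (simp add: inv_into_into)

lemma chart_inv_continuous: "(U, \<phi>) \<in> At \<Longrightarrow> continuous_on (\<phi> ` U) (inv_into U \<phi>)"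
  using chart_homeo homeomorphism_cont2 by blast

lemma chart_continuous: "(U, \<phi>) \<in> At \<Longrightarrow> continuous_on U \<phi>"
  using chart_homeo homeomorphism_cont1 by blast

lemma open_chart_image:
  assumes "(U, \<phi>) \<in> At" "open W" shows "open (\<phi> ` (W \<inter> U))"
proof -
  have "\<phi> ` (W \<inter> U) = \<phi> ` U \<inter> inv_into U \<phi> -` W"
    using chart_inv[OF assms(1)] by (auto simp: image_iff)
  then show ?thesis
    using continuous_open_preimage[OF chart_inv_continuous[OF assms(1)] _ assms(2)] chart_open[OF assms(1)]
    by simp
qed

lemma open_chart_preimage:
  assumes "(U, \<phi>) \<in> At" "open N" shows "open (U \<inter> \<phi> -` N)"
  using continuous_open_preimage[OF chart_continuous[OF assms(1)] _ assms(2)] chart_open[OF assms(1)]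
  by simp

text \<open>In any other chart the function is its expression in the given chart composed with a
  smooth transition map, so one chart around \<open>p\<close> decides. This spares all later
  arguments the quantifier over charts.\<close>

lemma smooth_near_chart:
  assumes c: "(U, \<phi>) \<in> At" and p: "p \<in> U"
  shows "smooth_near At p f \<longleftrightarrow>
    (\<exists>N. open N \<and> \<phi> p \<in> N \<and> N \<subseteq> \<phi> ` U \<and> smooth_on N (f \<circ> inv_into U \<phi>))"
proof
  assume "smooth_near At p f"
  then obtain W where "open W" "p \<in> W" "smooth_on (\<phi> ` (W \<inter> U)) (f \<circ> inv_into U \<phi>)"
    using c unfolding smooth_near_def by blast
  then show "\<exists>N. open N \<and> \<phi> p \<in> N \<and> N \<subseteq> \<phi> ` U \<and> smooth_on N (f \<circ> inv_into U \<phi>)"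
    using open_chart_image[OF c] p by (intro exI[of _ "\<phi> ` (W \<inter> U)"]) auto
next
  assume "\<exists>N. open N \<and> \<phi> p \<in> N \<and> N \<subseteq> \<phi> ` U \<and> smooth_on N (f \<circ> inv_into U \<phi>)"
  then obtain N where N: "open N" "\<phi> p \<in> N" "N \<subseteq> \<phi> ` U" "smooth_on N (f \<circ> inv_into U \<phi>)"
    by blast
  define W where "W = U \<inter> \<phi> -` N"
  have W: "open W" "p \<in> W" using open_chart_preimage[OF c N(1)] N(2) p by (auto simp: W_def)
  have "smooth_on (\<psi> ` (W \<inter> V)) (f \<circ> inv_into V \<psi>)" if d: "(V, \<psi>) \<in> At" for V \<psi>
  proof -
    have "smooth_on (\<psi> ` (W \<inter> V)) (\<lambda>b. (f \<circ> inv_into U \<phi>) ((\<phi> \<circ> inv_into V \<psi>) b))"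
    proof (rule smooth_on_compose[OF open_chart_image[OF d W(1)] N(1) _ _ N(4)])
      show "(\<phi> \<circ> inv_into V \<psi>) ` \<psi> ` (W \<inter> V) \<subseteq> N"
        by (auto simp: chart_inv[OF d] W_def)
      show "smooth_on (\<psi> ` (W \<inter> V)) (\<phi> \<circ> inv_into V \<psi>)"
        by (rule smooth_on_subset[OF charts_compat[OF d c]]) (auto simp: W_def)
    qed
    then show ?thesis
      by (rule smooth_on_cong[OF open_chart_image[OF d W(1)], rotated])
        (auto simp: chart_inv[OF d] chart_inv[OF c] W_def)
  qed
  then show "smooth_near At p f" using W unfolding smooth_near_def by blast
qed

lemma smooth_near_eventually:
  assumes "smooth_near At p f"
  obtains W where "open W" "p \<in> W" "\<And>q. q \<in> W \<Longrightarrow> smooth_near At q f"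
  using assms unfolding smooth_near_def by blast

lemma obtain_chart:
  obtains U \<phi> where "(U, \<phi>) \<in> At" "p \<in> U"
  using charts_cover[of p] by auto

lemma smooth_near_germ:
  assumes "open W" "p \<in> W" "\<And>q. q \<in> W \<Longrightarrow> f q = h q" "smooth_near At p f"
  shows "smooth_near At p h"
proof -
  obtain U \<phi> where c: "(U, \<phi>) \<in> At" "p \<in> U" by (rule obtain_chart)
  obtain N where N: "open N" "\<phi> p \<in> N" "N \<subseteq> \<phi> ` U" "smooth_on N (f \<circ> inv_into U \<phi>)"
    using assms(4) smooth_near_chart[OF c] by blast
  let ?N = "N \<inter> \<phi> ` (W \<inter> U)"
  have "open ?N" using open_chart_image[OF c(1) assms(1)] N(1) by blast
  moreover have "smooth_on ?N (h \<circ> inv_into U \<phi>)"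
    by (rule smooth_on_cong[OF \<open>open ?N\<close> _ smooth_on_subset[OF N(4)]])
      (auto simp: chart_inv[OF c(1)] assms(3))
  ultimately show ?thesis
    using N c(2) assms(2) unfolding smooth_near_chart[OF c] by (intro exI[of _ ?N]) auto
qed

lemma smooth_near_smooth_on:
  assumes c: "(U, \<phi>) \<in> At" and f: "\<And>q. q \<in> U \<Longrightarrow> smooth_near At q f"
  shows "smooth_on (\<phi> ` U) (f \<circ> inv_into U \<phi>)"
proof (rule smooth_on_local)
  show "open (\<phi> ` U)" using chart_open[OF c] by simp
  show "\<exists>T. open T \<and> b \<in> T \<and> smooth_on T (f \<circ> inv_into U \<phi>)" if "b \<in> \<phi> ` U" for b
    using f smooth_near_chart[OF c] that by blast
qed

lemma smooth_near_add:
  assumes "smooth_near At p f" "smooth_near At p h"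
  shows "smooth_near At p (\<lambda>q. f q + h q)"
proof -
  obtain U \<phi> where c: "(U, \<phi>) \<in> At" "p \<in> U" by (rule obtain_chart)
  obtain N where N: "open N" "\<phi> p \<in> N" "N \<subseteq> \<phi> ` U" "smooth_on N (f \<circ> inv_into U \<phi>)"
    using assms(1) smooth_near_chart[OF c] by blast
  obtain M where M: "open M" "\<phi> p \<in> M" "M \<subseteq> \<phi> ` U" "smooth_on M (h \<circ> inv_into U \<phi>)"
    using assms(2) smooth_near_chart[OF c] by blast
  have "smooth_on (N \<inter> M) (\<lambda>b. (f \<circ> inv_into U \<phi>) b + (h \<circ> inv_into U \<phi>) b)"
    using N(1) M(1)
    by (intro smooth_on_add open_Int smooth_on_subset[OF N(4)] smooth_on_subset[OF M(4)]) auto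
  then show ?thesis
    using N M unfolding smooth_near_chart[OF c] by (intro exI[of _ "N \<inter> M"]) (auto simp: comp_def)
qed

lemma smooth_near_cmult:
  assumes "smooth_near At p f"
  shows "smooth_near At p (\<lambda>q. k * f q)"
proof -
  obtain U \<phi> where c: "(U, \<phi>) \<in> At" "p \<in> U" by (rule obtain_chart)
  obtain N where N: "open N" "\<phi> p \<in> N" "N \<subseteq> \<phi> ` U" "smooth_on N (f \<circ> inv_into U \<phi>)"
    using assms(1) smooth_near_chart[OF c] by blast
  have "smooth_on N (\<lambda>b. k * (f \<circ> inv_into U \<phi>) b)"
    by (rule smooth_on_linear_compose[OF bounded_linear_mult_right N(1,4)])
  then show ?thesis
    using N unfolding smooth_near_chart[OF c] by (intro exI[of _ N]) (auto simp: comp_def)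
qed

lemma smooth_near_diff:
  assumes "smooth_near At p f" "smooth_near At p h"
  shows "smooth_near At p (\<lambda>q. f q - h q)"
  using smooth_near_add[OF assms(1) smooth_near_cmult[OF assms(2), of "-1"]] by simp

lemma smooth_near_has_derivative:
  assumes "(U, \<phi>) \<in> At" "p \<in> U" "smooth_near At p f"
  shows "(f \<circ> inv_into U \<phi> has_derivative D (f \<circ> inv_into U \<phi>) (\<phi> p)) (at (\<phi> p))"
  using assms(3) smooth_on_has_derivative unfolding smooth_near_chart[OF assms(1,2)] by blast

lemma smooth_near_coord:
  assumes c: "(U, \<phi>) \<in> At" and p: "p \<in> U"
  shows "smooth_near At p (\<lambda>q. \<phi> q \<bullet> i)"
proof -
  have "smooth_on (\<phi> ` U) ((\<lambda>q. \<phi> q \<bullet> i) \<circ> inv_into U \<phi>)"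
    by (rule smooth_on_cong[OF _ _ smooth_on_linear[OF bounded_linear_inner_left[of i]]])
      (auto simp: chart_inv[OF c] chart_open[OF c])
  then show ?thesis
    using chart_open[OF c] p unfolding smooth_near_chart[OF c p] by (intro exI[of _ "\<phi> ` U"]) auto
qed

text \<open>The coordinate functions serve as test functions that recover \<open>w\<close>. They are
  smooth near \<open>p\<close> whatever \<open>\<phi>\<close> does outside \<open>U\<close>, because
  only the germ counts.\<close>

lemma chart_vector_coord:
  assumes c: "(U, \<phi>) \<in> At" and p: "p \<in> U"
  shows "chart_vector At U \<phi> p w (\<lambda>q. \<phi> q \<bullet> i) = w \<bullet> i"
proof -
  have "((\<lambda>q. \<phi> q \<bullet> i) \<circ> inv_into U \<phi> has_derivative (\<lambda>w. w \<bullet> i)) (at (\<phi> p))"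
    by (rule has_derivative_transform_within_open[where f = "\<lambda>w. w \<bullet> i" and s = "\<phi> ` U"])
      (auto simp: chart_inv[OF c] chart_open[OF c] p intro!: derivative_eq_intros)
  then show ?thesis by (simp add: chart_vector_def smooth_near_coord[OF assms] D_eqI)
qed

lemma chart_vector_inject:
  assumes "(U, \<phi>) \<in> At" "p \<in> U" "chart_vector At U \<phi> p w = chart_vector At U \<phi> p w'"
  shows "w = w'"
  by (rule euclidean_eqI) (metis assms chart_vector_coord)

lemma chart_vector_add:
  assumes "(U, \<phi>) \<in> At" "p \<in> U"
  shows "chart_vector At U \<phi> p (w + w') = chart_vector At U \<phi> p w + chart_vector At U \<phi> p w'"
  using smooth_near_has_derivative[OF assms]
  by (auto simp: chart_vector_def fun_eq_iff dest!: has_derivative_linear intro: linear_add)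

lemma chart_vector_scaleR:
  assumes "(U, \<phi>) \<in> At" "p \<in> U"
  shows "chart_vector At U \<phi> p (k *\<^sub>R w) = k *\<^sub>R chart_vector At U \<phi> p w"
  using linear_scale[OF has_derivative_linear[OF smooth_near_has_derivative[OF assms]]]
  by (auto simp: chart_vector_def fun_eq_iff scaleR_fun_def)

text \<open>The chain rule, in a form that covers changes of charts (\<open>L = id\<close>) and left translations.\<close>

lemma chart_pushforward:
  assumes c: "(V, \<psi>) \<in> At" "p \<in> V" and d: "(U, \<phi>) \<in> At"
    and N: "open N" "\<psi> p \<in> N" "N \<subseteq> \<psi> ` V" "\<And>b. b \<in> N \<Longrightarrow> L (inv_into V \<psi> b) \<in> U"
    and L: "smooth_on N (\<lambda>b. \<phi> (L (inv_into V \<psi> b)))"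
    and f: "smooth_near At (L p) f"
  shows "smooth_near At p (\<lambda>q. f (L q))"
    and "D ((\<lambda>q. f (L q)) \<circ> inv_into V \<psi>) (\<psi> p) w =
      D (f \<circ> inv_into U \<phi>) (\<phi> (L p)) (D (\<lambda>b. \<phi> (L (inv_into V \<psi> b))) (\<psi> p) w)"
proof -
  let ?F = "\<lambda>b. \<phi> (L (inv_into V \<psi> b))"
  have Lp: "L p \<in> U" "?F (\<psi> p) = \<phi> (L p)" using N(4)[OF N(2)] by (auto simp: chart_inv[OF c])
  obtain M where M: "open M" "\<phi> (L p) \<in> M" "M \<subseteq> \<phi> ` U" "smooth_on M (f \<circ> inv_into U \<phi>)"
    using f smooth_near_chart[OF d Lp(1)] by blast
  let ?N = "N \<inter> ?F -` M"
  have o: "open ?N" using continuous_open_preimage[OF smooth_on_continuous[OF L] N(1) M(1)] .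
  have p: "\<psi> p \<in> ?N" using N(2) M(2) Lp by auto
  have sub: "?F ` ?N \<subseteq> M" by auto
  have eq: "(f \<circ> inv_into U \<phi>) (?F b) = ((\<lambda>q. f (L q)) \<circ> inv_into V \<psi>) b" if "b \<in> ?N" for b
    using N(4) that by (auto simp: chart_inv[OF d])
  have sm: "smooth_on ?N (\<lambda>b. (f \<circ> inv_into U \<phi>) (?F b))"
    by (rule smooth_on_compose[OF o M(1) sub smooth_on_subset[OF L] M(4)]) auto
  then have "smooth_on ?N ((\<lambda>q. f (L q)) \<circ> inv_into V \<psi>)"
    by (rule smooth_on_cong[OF o, rotated]) (rule eq)
  then show "smooth_near At p (\<lambda>q. f (L q))"
    using o p N(3) unfolding smooth_near_chart[OF c] by blast
  have "((\<lambda>b. (f \<circ> inv_into U \<phi>) (?F b)) has_derivative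
      (\<lambda>w. D (f \<circ> inv_into U \<phi>) (\<phi> (L p)) (D ?F (\<psi> p) w))) (at (\<psi> p))"
    by (rule has_derivative_compose[OF smooth_on_has_derivative[OF N(1) L N(2)]])
      (use smooth_on_has_derivative[OF M(1,4,2)] Lp(2) in \<open>simp add: comp_def\<close>)
  then have "((\<lambda>q. f (L q)) \<circ> inv_into V \<psi> has_derivative
      (\<lambda>w. D (f \<circ> inv_into U \<phi>) (\<phi> (L p)) (D ?F (\<psi> p) w))) (at (\<psi> p))"
    by (rule has_derivative_transform_within_open[OF _ o p]) (rule eq)
  then show "D ((\<lambda>q. f (L q)) \<circ> inv_into V \<psi>) (\<psi> p) w =
      D (f \<circ> inv_into U \<phi>) (\<phi> (L p)) (D ?F (\<psi> p) w)"
    by (simp add: D_eqI)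
qed

lemma chart_vector_change:
  assumes c: "(V, \<psi>) \<in> At" "p \<in> V" and d: "(U, \<phi>) \<in> At" "p \<in> U"
  shows "chart_vector At V \<psi> p w = chart_vector At U \<phi> p (D (\<phi> \<circ> inv_into V \<psi>) (\<psi> p) w)"
proof -
  have N: "open (\<psi> ` (U \<inter> V))" "\<psi> p \<in> \<psi> ` (U \<inter> V)" "\<psi> ` (U \<inter> V) \<subseteq> \<psi> ` V"
      "\<And>b. b \<in> \<psi> ` (U \<inter> V) \<Longrightarrow> inv_into V \<psi> b \<in> U"
    using c d open_chart_image[OF c(1)] chart_open[OF d(1)] by (auto simp: chart_inv)
  have L: "smooth_on (\<psi> ` (U \<inter> V)) (\<lambda>b. \<phi> (inv_into V \<psi> b))"
    using charts_compat[OF c(1) d(1)] by (simp add: comp_def Int_commute)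
  have "D (f \<circ> inv_into V \<psi>) (\<psi> p) w =
      D (f \<circ> inv_into U \<phi>) (\<phi> p) (D (\<phi> \<circ> inv_into V \<psi>) (\<psi> p) w)" if "smooth_near At p f" for f
    using chart_pushforward(2)[where L = "\<lambda>q. q", OF c d(1) N L that] by (simp add: comp_def)
  then show ?thesis by (auto simp: chart_vector_def)
qed

lemma tangent_space_chart:
  assumes "(U, \<phi>) \<in> At" "p \<in> U"
  shows "tangent_space At p = range (chart_vector At U \<phi> p)"
proof
  show "tangent_space At p \<subseteq> range (chart_vector At U \<phi> p)"
  proof
    fix v assume "v \<in> tangent_space At p"
    then obtain V \<psi> w where "(V, \<psi>) \<in> At" "p \<in> V" "v = chart_vector At V \<psi> p w"
      by (auto simp: tangent_space_def chart_vector_def)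
    then show "v \<in> range (chart_vector At U \<phi> p)"
      using chart_vector_change assms by blast
  qed
  show "range (chart_vector At U \<phi> p) \<subseteq> tangent_space At p"
    using chart_vector_in_tangent_space[OF assms] by blast
qed

lemma tangent_vector_cases:
  assumes "v \<in> tangent_space At p"
  obtains U \<phi> w where "(U, \<phi>) \<in> At" "p \<in> U" "v = chart_vector At U \<phi> p w"
  using assms by (auto simp: tangent_space_def chart_vector_def)

lemma tangent_vector_coord:
  assumes c: "(U, \<phi>) \<in> At" "p \<in> U" and v: "v \<in> tangent_space At p"
  shows "v = chart_vector At U \<phi> p (\<Sum>i\<in>Basis. v (\<lambda>q. \<phi> q \<bullet> i) *\<^sub>R i)"
proof -
  obtain w where w: "v = chart_vector At U \<phi> p w"
    using v tangent_space_chart[OF c] by blast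
  show ?thesis unfolding w by (simp add: chart_vector_coord[OF c] euclidean_representation)
qed

lemma tangent_not_smooth:
  "v \<in> tangent_space At p \<Longrightarrow> \<not> smooth_near At p f \<Longrightarrow> v f = 0"
  by (elim tangent_vector_cases) (simp add: chart_vector_def)

lemma tangent_germ:
  assumes v: "v \<in> tangent_space At p" and W: "open W" "p \<in> W" "\<And>q. q \<in> W \<Longrightarrow> f q = h q"
  shows "v f = v h"
proof (cases "smooth_near At p f")
  case False
  \<comment> \<open>Smoothness near \<open>p\<close> also depends only on the germ, so both values
    are the default \<open>0\<close>.\<close>
  then show ?thesis
    using tangent_not_smooth[OF v] smooth_near_germ[OF W(1,2), of h f] W(3) by metis
next
  case True
  obtain U \<phi> w where c: "(U, \<phi>) \<in> At" "p \<in> U" and w: "v = chart_vector At U \<phi> p w"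
    using v by (rule tangent_vector_cases)
  have "D (h \<circ> inv_into U \<phi>) (\<phi> p) = D (f \<circ> inv_into U \<phi>) (\<phi> p)"
    by (rule D_cong[OF open_chart_image[OF c(1) W(1)]])
      (use c W smooth_near_has_derivative[OF c True] in \<open>auto simp: chart_inv differentiable_def\<close>)
  then show ?thesis
    using True smooth_near_germ[OF W True] by (simp add: w chart_vector_def)
qed

lemma tangent_add:
  assumes v: "v \<in> tangent_space At p" and f: "smooth_near At p f" and h: "smooth_near At p h"
  shows "v (\<lambda>q. f q + h q) = v f + v h"
proof -
  obtain U \<phi> w where c: "(U, \<phi>) \<in> At" "p \<in> U" and w: "v = chart_vector At U \<phi> p w"
    using v by (rule tangent_vector_cases)
  have "D ((\<lambda>q. f q + h q) \<circ> inv_into U \<phi>) (\<phi> p) =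
      (\<lambda>w. D (f \<circ> inv_into U \<phi>) (\<phi> p) w + D (h \<circ> inv_into U \<phi>) (\<phi> p) w)"
    by (rule D_eqI) (use has_derivative_add[OF smooth_near_has_derivative[OF c f]
        smooth_near_has_derivative[OF c h]] in \<open>simp add: comp_def\<close>)
  then show ?thesis by (simp add: w chart_vector_def f h smooth_near_add[OF f h])
qed

lemma tangent_cmult:
  assumes v: "v \<in> tangent_space At p" and f: "smooth_near At p f"
  shows "v (\<lambda>q. k * f q) = k * v f"
proof -
  obtain U \<phi> w where c: "(U, \<phi>) \<in> At" "p \<in> U" and w: "v = chart_vector At U \<phi> p w"
    using v by (rule tangent_vector_cases)
  have "D ((\<lambda>q. k * f q) \<circ> inv_into U \<phi>) (\<phi> p) = (\<lambda>w. k * D (f \<circ> inv_into U \<phi>) (\<phi> p) w)"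
    by (rule D_eqI) (use has_derivative_mult_right[OF smooth_near_has_derivative[OF c f], of k]
        in \<open>simp add: comp_def\<close>)
  then show ?thesis by (simp add: w chart_vector_def f smooth_near_cmult[OF f])
qed

lemma tangent_diff:
  assumes v: "v \<in> tangent_space At p" and f: "smooth_near At p f" and h: "smooth_near At p h"
  shows "v (\<lambda>q. f q - h q) = v f - v h"
  using tangent_add[OF v f smooth_near_cmult[OF h, of "-1"]] tangent_cmult[OF v h, of "-1"] by simp

lemma smooth_vf_tangent: "smooth_vector_field At X \<Longrightarrow> X p \<in> tangent_space At p"
  by (simp add: smooth_vector_field_def)

lemma smooth_vf_smooth:
  "smooth_vector_field At X \<Longrightarrow> smooth_near At p f \<Longrightarrow> smooth_near At p (\<lambda>q. X q f)"
  by (simp add: smooth_vector_field_def)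

text \<open>The coefficients are the values of the field on the coordinate functions; they are
  smooth because a smooth field maps smooth functions to smooth functions.\<close>

lemma smooth_vf_chart:
  assumes X: "smooth_vector_field At X" and c: "(U, \<phi>) \<in> At"
  obtains \<xi> where "smooth_on (\<phi> ` U) \<xi>" "\<And>q. q \<in> U \<Longrightarrow> X q = chart_vector At U \<phi> q (\<xi> (\<phi> q))"
proof
  let ?\<xi> = "\<lambda>b. \<Sum>i\<in>Basis. ((\<lambda>q. X q (\<lambda>q. \<phi> q \<bullet> i)) \<circ> inv_into U \<phi>) b *\<^sub>R i"
  show "smooth_on (\<phi> ` U) ?\<xi>"
    using chart_open[OF c]
    by (intro smooth_on_sum smooth_on_scaleR smooth_near_smooth_on c smooth_vf_smooth[OF X]
        smooth_near_coord[OF c] smooth_on_const) auto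
  show "X q = chart_vector At U \<phi> q (?\<xi> (\<phi> q))" if "q \<in> U" for q
    using tangent_vector_coord[OF c that smooth_vf_tangent[OF X]] by (simp add: chart_inv[OF c that])
qed

end

text \<open>In a basis this is the product rule. Freezing the direction at \<open>w a\<close>
  isolates the Hessian of \<open>f\<close>, which cancels by symmetry when two fields are
  commuted.\<close>

lemma D_field:
  fixes f :: "'a::euclidean_space \<Rightarrow> real"
  assumes S: "open S" "a \<in> S" and f: "smooth_on S f" and w: "smooth_on S w"
  shows "D (\<lambda>x. D f x (w x)) a u = D f a (D w a u) + D (\<lambda>x. D f x (w a)) a u"
proof -
  have lin: "D f x v = (\<Sum>i\<in>Basis. (v \<bullet> i) * D f x i)" if "x \<in> S" for x v
    using linear_eq_sum_Basis[OF smooth_on_linear_D[OF S(1) f that], of v] by simp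
  have fi: "((\<lambda>x. D f x i) has_derivative D (\<lambda>x. D f x i) a) (at a)" for i
    by (rule smooth_on_has_derivative[OF S(1) smooth_on_D[OF f] S(2)])
  have wi: "(w has_derivative D w a) (at a)"
    by (rule smooth_on_has_derivative[OF S(1) w S(2)])
  have "((\<lambda>x. \<Sum>i\<in>Basis. (w x \<bullet> i) * D f x i) has_derivative
      (\<lambda>u. \<Sum>i\<in>Basis. (w a \<bullet> i) * D (\<lambda>x. D f x i) a u + (D w a u \<bullet> i) * D f a i)) (at a)"
    by (intro has_derivative_sum has_derivative_mult has_derivative_inner_left wi fi)
  then have 1: "((\<lambda>x. D f x (w x)) has_derivative
      (\<lambda>u. \<Sum>i\<in>Basis. (w a \<bullet> i) * D (\<lambda>x. D f x i) a u + (D w a u \<bullet> i) * D f a i)) (at a)"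
    by (rule has_derivative_transform_within_open[OF _ S]) (rule lin[symmetric])
  have "((\<lambda>x. \<Sum>i\<in>Basis. (w a \<bullet> i) * D f x i) has_derivative
      (\<lambda>u. \<Sum>i\<in>Basis. (w a \<bullet> i) * D (\<lambda>x. D f x i) a u)) (at a)"
    by (intro has_derivative_sum has_derivative_mult_right fi)
  then have 2: "((\<lambda>x. D f x (w a)) has_derivative
      (\<lambda>u. \<Sum>i\<in>Basis. (w a \<bullet> i) * D (\<lambda>x. D f x i) a u)) (at a)"
    by (rule has_derivative_transform_within_open[OF _ S]) (rule lin[symmetric])
  show ?thesis
    unfolding D_eqI[OF 1] D_eqI[OF 2] lin[OF S(2), of "D w a u"] by (simp add: sum.distrib)
qed

section \<open>The Lie bracket of smooth vector fields\<close>

context smooth_manifold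
begin

text \<open>The second-order terms of the two compositions are the Hessian of \<open>f\<close>
  applied to the same two vectors in opposite order. They cancel, and what remains is a first-order
  operator, that is, a tangent vector.\<close>

lemma field_bracket_chart:
  assumes X: "smooth_vector_field At X" and Y: "smooth_vector_field At Y"
    and c: "(U, \<phi>) \<in> At" "p \<in> U"
    and \<xi>: "smooth_on (\<phi> ` U) \<xi>" "\<And>q. q \<in> U \<Longrightarrow> X q = chart_vector At U \<phi> q (\<xi> (\<phi> q))"
    and \<eta>: "smooth_on (\<phi> ` U) \<eta>" "\<And>q. q \<in> U \<Longrightarrow> Y q = chart_vector At U \<phi> q (\<eta> (\<phi> q))"
  shows "field_bracket At X Y p =
    chart_vector At U \<phi> p (D \<eta> (\<phi> p) (\<xi> (\<phi> p)) - D \<xi> (\<phi> p) (\<eta> (\<phi> p)))"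
proof
  fix f
  show "field_bracket At X Y p f =
    chart_vector At U \<phi> p (D \<eta> (\<phi> p) (\<xi> (\<phi> p)) - D \<xi> (\<phi> p) (\<eta> (\<phi> p))) f"
  proof (cases "smooth_near At p f")
    case True
    let ?f = "f \<circ> inv_into U \<phi>"
    obtain N where N: "open N" "\<phi> p \<in> N" "N \<subseteq> \<phi> ` U" "smooth_on N ?f"
      using True smooth_near_chart[OF c] by blast
    \<comment> \<open>Only the value of \<open>Z\<close> at \<open>p\<close> enters, while
      \<open>Y\<close> is differentiated around \<open>p\<close>. The claim is general in both
      fields so that it covers both orders of composition.\<close>
    have app: "Z p (\<lambda>q. Y q f) = D ?f (\<phi> p) (D \<eta> (\<phi> p) (\<zeta> (\<phi> p))) +
        D (\<lambda>x. D ?f x (\<eta> (\<phi> p))) (\<phi> p) (\<zeta> (\<phi> p))"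
      if Y: "smooth_vector_field At Y"
        and \<eta>: "smooth_on (\<phi> ` U) \<eta>" "\<And>q. q \<in> U \<Longrightarrow> Y q = chart_vector At U \<phi> q (\<eta> (\<phi> q))"
        and Z: "Z p = chart_vector At U \<phi> p (\<zeta> (\<phi> p))" for Y Z \<zeta> \<eta>
    proof -
      have sm: "smooth_near At p (\<lambda>q. Y q f)" by (rule smooth_vf_smooth[OF Y True])
      have "D ?f b (\<eta> b) = ((\<lambda>q. Y q f) \<circ> inv_into U \<phi>) b" if "b \<in> N" for b
      proof -
        obtain q where q: "q \<in> U" "b = \<phi> q" using N(3) \<open>b \<in> N\<close> by blast
        have "smooth_near At q f"
          unfolding smooth_near_chart[OF c(1) q(1)] using N q(2) \<open>b \<in> N\<close> by blast
        then show ?thesis using \<eta>(2)[OF q(1)] by (simp add: q chart_inv[OF c(1) q(1)] chart_vector_def)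
      qed
      then have "D ((\<lambda>q. Y q f) \<circ> inv_into U \<phi>) (\<phi> p) = D (\<lambda>b. D ?f b (\<eta> b)) (\<phi> p)"
        by (rule D_cong[OF N(1,2)])
          (use smooth_on_has_derivative[OF N(1) smooth_on_D_field[OF N(1,4) smooth_on_subset[OF \<eta>(1) N(3)]] N(2)]
            in \<open>auto simp: differentiable_def\<close>)
      then show ?thesis
        using D_field[OF N(1,2,4) smooth_on_subset[OF \<eta>(1) N(3)]]
        by (simp add: Z chart_vector_def sm)
    qed
    have "linear (D ?f (\<phi> p))" by (rule smooth_on_linear_D[OF N(1,4,2)])
    then show ?thesis
      using app[OF Y \<eta>, of X \<xi>] app[OF X \<xi>, of Y \<eta>] \<xi>(2)[OF c(2)] \<eta>(2)[OF c(2)] True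
        smooth_on_second_derivative_symmetric[OF N(1,4,2), of "\<xi> (\<phi> p)" "\<eta> (\<phi> p)"]
      by (simp add: field_bracket_def chart_vector_def linear_diff)
  qed (simp add: field_bracket_def chart_vector_def)
qed

lemma field_bracket_smooth:
  assumes X: "smooth_vector_field At X" and Y: "smooth_vector_field At Y"
  shows "smooth_vector_field At (field_bracket At X Y)"
  unfolding smooth_vector_field_def
proof (intro conjI allI impI)
  fix p
  obtain U \<phi> where c: "(U, \<phi>) \<in> At" "p \<in> U" by (rule obtain_chart)
  obtain \<xi> where \<xi>: "smooth_on (\<phi> ` U) \<xi>" "\<And>q. q \<in> U \<Longrightarrow> X q = chart_vector At U \<phi> q (\<xi> (\<phi> q))"
    using smooth_vf_chart[OF X c(1)] by blast
  obtain \<eta> where \<eta>: "smooth_on (\<phi> ` U) \<eta>" "\<And>q. q \<in> U \<Longrightarrow> Y q = chart_vector At U \<phi> q (\<eta> (\<phi> q))"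
    using smooth_vf_chart[OF Y c(1)] by blast
  show "field_bracket At X Y p \<in> tangent_space At p"
    using field_bracket_chart[OF X Y c \<xi> \<eta>] chart_vector_in_tangent_space[OF c] by simp
next
  fix p f assume f: "smooth_near At p f"
  obtain W where W: "open W" "p \<in> W" "\<And>q. q \<in> W \<Longrightarrow> smooth_near At q f"
    using smooth_near_eventually[OF f] by blast
  have "smooth_near At p (\<lambda>q. X q (\<lambda>q. Y q f) - Y q (\<lambda>q. X q f))"
    by (rule smooth_near_diff[OF smooth_vf_smooth[OF X smooth_vf_smooth[OF Y f]]
          smooth_vf_smooth[OF Y smooth_vf_smooth[OF X f]]])
  then show "smooth_near At p (\<lambda>q. field_bracket At X Y q f)"
    by (rule smooth_near_germ[OF W(1,2), rotated]) (simp add: field_bracket_def W(3))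
qed

text \<open>Smoothness carries the argument: \<open>Z p\<close> is additive because it is a tangent
  vector, and only on functions smooth near \<open>p\<close>.\<close>

lemma field_bracket_add_left:
  assumes "smooth_vector_field At X" "smooth_vector_field At Y" "smooth_vector_field At Z"
  shows "field_bracket At (X + Y) Z = field_bracket At X Z + field_bracket At Y Z"
  by (auto simp: field_bracket_def fun_eq_iff assms smooth_vf_smooth[OF assms(1)] smooth_vf_smooth[OF assms(2)]
      smooth_vf_smooth[OF assms(3)] tangent_add[OF smooth_vf_tangent[OF assms(3)]])

lemma field_bracket_scaleR_left:
  assumes "smooth_vector_field At X" "smooth_vector_field At Z"
  shows "field_bracket At (k *\<^sub>R X) Z = k *\<^sub>R field_bracket At X Z"
  by (auto simp: field_bracket_def fun_eq_iff scaleR_fun_def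
      tangent_cmult[OF smooth_vf_tangent[OF assms(2)]] smooth_vf_smooth[OF assms(1)] algebra_simps)

lemma field_bracket_skew: "field_bracket At X Y = - field_bracket At Y X"
  by (auto simp: field_bracket_def fun_eq_iff)

lemma field_bracket_jacobi:
  assumes "smooth_vector_field At X" "smooth_vector_field At Y" "smooth_vector_field At Z"
  shows "field_bracket At X (field_bracket At Y Z) + field_bracket At Y (field_bracket At Z X)
    + field_bracket At Z (field_bracket At X Y) = 0"
proof (intro ext)
  fix p f
  \<comment> \<open>The three cyclic instances of these four terms cancel in pairs.\<close>
  have expand: "field_bracket At X (field_bracket At Y Z) p f =
      X p (\<lambda>q. Y q (\<lambda>q. Z q f)) - X p (\<lambda>q. Z q (\<lambda>q. Y q f))
      - Y p (\<lambda>q. Z q (\<lambda>q. X q f)) + Z p (\<lambda>q. Y q (\<lambda>q. X q f))"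
    if f: "smooth_near At p f" and X: "smooth_vector_field At X" and Y: "smooth_vector_field At Y"
      and Z: "smooth_vector_field At Z" for X Y Z
  proof -
    obtain W where W: "open W" "p \<in> W" "\<And>q. q \<in> W \<Longrightarrow> smooth_near At q f"
      using smooth_near_eventually[OF f] by blast
    \<comment> \<open>The inner bracket is the commutator only at points near which \<open>f\<close>
      is smooth; these fill a neighbourhood of \<open>p\<close>, and a tangent vector sees no more
      than the germ.\<close>
    have "X p (\<lambda>q. field_bracket At Y Z q f) = X p (\<lambda>q. Y q (\<lambda>q. Z q f) - Z q (\<lambda>q. Y q f))"
      by (rule tangent_germ[OF smooth_vf_tangent[OF X] W(1,2)]) (simp add: field_bracket_def W(3))
    also have "\<dots> = X p (\<lambda>q. Y q (\<lambda>q. Z q f)) - X p (\<lambda>q. Z q (\<lambda>q. Y q f))"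
      by (rule tangent_diff[OF smooth_vf_tangent[OF X] smooth_vf_smooth[OF Y smooth_vf_smooth[OF Z f]]
            smooth_vf_smooth[OF Z smooth_vf_smooth[OF Y f]]])
    finally show ?thesis
      by (simp add: field_bracket_def[of At X] f) (simp add: field_bracket_def smooth_vf_smooth X f)
  qed
  show "(field_bracket At X (field_bracket At Y Z) + field_bracket At Y (field_bracket At Z X)
    + field_bracket At Z (field_bracket At X Y)) p f = 0 p f"
  proof (cases "smooth_near At p f")
    case True
    then show ?thesis by (simp add: expand assms)
  qed (simp add: field_bracket_def)
qed

end

section \<open>Left-invariant fields\<close>

context lie_group
begin

lemma mult_assoc: "(x \<otimes>\<^bsub>G\<^esub> y) \<otimes>\<^bsub>G\<^esub> z = x \<otimes>\<^bsub>G\<^esub> (y \<otimes>\<^bsub>G\<^esub> z)"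
  by (simp add: m_assoc carrier_UNIV)

lemma mult_one: "\<one>\<^bsub>G\<^esub> \<otimes>\<^bsub>G\<^esub> x = x" "x \<otimes>\<^bsub>G\<^esub> \<one>\<^bsub>G\<^esub> = x"
  by (simp_all add: carrier_UNIV)

lemma inv_mult_cancel: "inv\<^bsub>G\<^esub> a \<otimes>\<^bsub>G\<^esub> (a \<otimes>\<^bsub>G\<^esub> x) = x"
  by (simp add: carrier_UNIV flip: mult_assoc)

text \<open>Rewrites the set of coordinate pairs from \<open>mult_smooth\<close> as a preimage under
  a continuous map. This yields its openness, which the calculus of smooth maps needs.\<close>

lemma mult_chart:
  assumes c: "(U, \<phi>) \<in> At" and d: "(V, \<psi>) \<in> At" and e: "(W, \<omega>) \<in> At"
  defines "S \<equiv> {z \<in> \<phi> ` U \<times> \<psi> ` V. inv_into U \<phi> (fst z) \<otimes>\<^bsub>G\<^esub> inv_into V \<psi> (snd z) \<in> W}"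
  shows "open S" "smooth_on S (\<lambda>z. \<omega> (inv_into U \<phi> (fst z) \<otimes>\<^bsub>G\<^esub> inv_into V \<psi> (snd z)))"
proof -
  have "continuous_on (\<phi> ` U \<times> \<psi> ` V) (\<lambda>z. (\<lambda>(x, y). x \<otimes>\<^bsub>G\<^esub> y) (inv_into U \<phi> (fst z), inv_into V \<psi> (snd z)))"
    by (rule continuous_on_compose2[OF mult_continuous])
      (auto intro!: continuous_on_Pair continuous_on_compose2[OF chart_inv_continuous[OF c]]
        continuous_on_compose2[OF chart_inv_continuous[OF d]] continuous_on_fst continuous_on_snd continuous_on_id)
  then have "open ((\<phi> ` U \<times> \<psi> ` V) \<inter> (\<lambda>z. inv_into U \<phi> (fst z) \<otimes>\<^bsub>G\<^esub> inv_into V \<psi> (snd z)) -` W)"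
    by (intro continuous_open_preimage open_Times) (simp_all add: chart_open[OF c] chart_open[OF d] chart_open[OF e])
  moreover have "S = (\<phi> ` U \<times> \<psi> ` V) \<inter> (\<lambda>z. inv_into U \<phi> (fst z) \<otimes>\<^bsub>G\<^esub> inv_into V \<psi> (snd z)) -` W"
    by (auto simp: S_def)
  ultimately show "open S" by simp
  have "{(\<phi> x, \<psi> y) | x y. x \<in> U \<and> y \<in> V \<and> x \<otimes>\<^bsub>G\<^esub> y \<in> W} = S"
    by (force simp: S_def chart_inv[OF c] chart_inv[OF d])
  then show "smooth_on S (\<lambda>z. \<omega> (inv_into U \<phi> (fst z) \<otimes>\<^bsub>G\<^esub> inv_into V \<psi> (snd z)))"
    using mult_smooth[OF c d e] by (simp add: case_prod_unfold)
qed

text \<open>Left translation by \<open>a\<close> is multiplication with the first coordinate frozen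
  at that of \<open>a\<close>; \<open>N\<close> is the corresponding slice of the domain of
  multiplication.\<close>

lemma left_translation_chart:
  assumes c: "(V, \<psi>) \<in> At" "p \<in> V" and d: "(U, \<phi>) \<in> At" "a \<otimes>\<^bsub>G\<^esub> p \<in> U"
  obtains N where "open N" "\<psi> p \<in> N" "N \<subseteq> \<psi> ` V" "\<And>b. b \<in> N \<Longrightarrow> a \<otimes>\<^bsub>G\<^esub> inv_into V \<psi> b \<in> U"
    "smooth_on N (\<lambda>b. \<phi> (a \<otimes>\<^bsub>G\<^esub> inv_into V \<psi> b))"
proof -
  obtain A \<alpha> where e: "(A, \<alpha>) \<in> At" "a \<in> A" by (rule obtain_chart)
  define S where "S = {z \<in> \<alpha> ` A \<times> \<psi> ` V. inv_into A \<alpha> (fst z) \<otimes>\<^bsub>G\<^esub> inv_into V \<psi> (snd z) \<in> U}"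
  have S: "open S" "smooth_on S (\<lambda>z. \<phi> (inv_into A \<alpha> (fst z) \<otimes>\<^bsub>G\<^esub> inv_into V \<psi> (snd z)))"
    using mult_chart[OF e(1) c(1) d(1)] unfolding S_def .
  define N where "N = (\<lambda>b. (\<alpha> a, b)) -` S"
  have N: "open N"
    unfolding N_def by (rule open_vimage[OF S(1)]) (intro continuous_intros)
  \<comment> \<open>The inclusion of the slice, written as a linear map plus a constant.\<close>
  have "smooth_on N (\<lambda>b. (0, b) + (\<alpha> a, 0))"
    by (intro smooth_on_add smooth_on_const smooth_on_linear N)
      (intro bounded_linear_Pair bounded_linear_zero bounded_linear_ident)
  then have "smooth_on N (\<lambda>b. (\<alpha> a, b))" by simp
  then have "smooth_on N (\<lambda>b. \<phi> (inv_into A \<alpha> (fst (\<alpha> a, b)) \<otimes>\<^bsub>G\<^esub> inv_into V \<psi> (snd (\<alpha> a, b))))"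
    by (rule smooth_on_compose[OF N S(1) _ _ S(2), rotated]) (auto simp: N_def)
  then show thesis
    using N c(2) d(2) imageI[OF e(2), of \<alpha>] by (intro that[of N]) (auto simp: N_def S_def chart_inv[OF e] chart_inv[OF c])
qed

lemma smooth_near_left_translation:
  "smooth_near At p (\<lambda>q. f (a \<otimes>\<^bsub>G\<^esub> q)) \<longleftrightarrow> smooth_near At (a \<otimes>\<^bsub>G\<^esub> p) f"
proof -
  have *: "smooth_near At p (\<lambda>q. f (a \<otimes>\<^bsub>G\<^esub> q))" if "smooth_near At (a \<otimes>\<^bsub>G\<^esub> p) f" for f a p
  proof -
    obtain V \<psi> where c: "(V, \<psi>) \<in> At" "p \<in> V" by (rule obtain_chart)
    obtain U \<phi> where d: "(U, \<phi>) \<in> At" "a \<otimes>\<^bsub>G\<^esub> p \<in> U" by (rule obtain_chart)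
    obtain N where N: "open N" "\<psi> p \<in> N" "N \<subseteq> \<psi> ` V" "\<And>b. b \<in> N \<Longrightarrow> a \<otimes>\<^bsub>G\<^esub> inv_into V \<psi> b \<in> U"
        "smooth_on N (\<lambda>b. \<phi> (a \<otimes>\<^bsub>G\<^esub> inv_into V \<psi> b))"
      using left_translation_chart[OF c d] by blast
    show ?thesis by (rule chart_pushforward(1)[where L = "\<lambda>q. a \<otimes>\<^bsub>G\<^esub> q", OF c d(1) N that])
  qed
  \<comment> \<open>The converse is the same implication for translation by the inverse of
    \<open>a\<close>, applied to the translated function.\<close>
  show ?thesis
    using *[of a p f] *[of "inv\<^bsub>G\<^esub> a" "a \<otimes>\<^bsub>G\<^esub> p" "\<lambda>q. f (a \<otimes>\<^bsub>G\<^esub> q)"]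
    by (auto simp: inv_mult_cancel carrier_UNIV simp flip: mult_assoc)
qed

lemma left_push_tangent:
  assumes "v \<in> tangent_space At p"
  shows "left_push G a v \<in> tangent_space At (a \<otimes>\<^bsub>G\<^esub> p)"
proof -
  obtain V \<psi> w where c: "(V, \<psi>) \<in> At" "p \<in> V" and w: "v = chart_vector At V \<psi> p w"
    using assms by (rule tangent_vector_cases)
  obtain U \<phi> where d: "(U, \<phi>) \<in> At" "a \<otimes>\<^bsub>G\<^esub> p \<in> U" by (rule obtain_chart)
  obtain N where N: "open N" "\<psi> p \<in> N" "N \<subseteq> \<psi> ` V" "\<And>b. b \<in> N \<Longrightarrow> a \<otimes>\<^bsub>G\<^esub> inv_into V \<psi> b \<in> U"
      "smooth_on N (\<lambda>b. \<phi> (a \<otimes>\<^bsub>G\<^esub> inv_into V \<psi> b))"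
    using left_translation_chart[OF c d] by blast
  have "left_push G a v = chart_vector At U \<phi> (a \<otimes>\<^bsub>G\<^esub> p) (D (\<lambda>b. \<phi> (a \<otimes>\<^bsub>G\<^esub> inv_into V \<psi> b)) (\<psi> p) w)"
    using chart_pushforward(2)[where L = "\<lambda>q. a \<otimes>\<^bsub>G\<^esub> q", OF c d(1) N]
    by (auto simp: left_push_def chart_vector_def w smooth_near_left_translation)
  then show ?thesis using chart_vector_in_tangent_space[OF d] by simp
qed

definition left_invariant_field :: "'g set \<Rightarrow> ('g \<Rightarrow> 'a) \<Rightarrow> 'a \<Rightarrow> 'g vector_field"
  where "left_invariant_field U \<phi> w = (\<lambda>a. left_push G a (chart_vector At U \<phi> \<one>\<^bsub>G\<^esub> w))"

text \<open>Applied to \<open>f\<close>, the field at \<open>q\<close> is the derivative of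
  \<open>f (q x)\<close> with respect to \<open>x\<close> at the identity. In charts this is a
  partial derivative, in direction \<open>(0, w)\<close>, of the jointly smooth function
  \<open>H\<close>, and hence smooth in the coordinates of \<open>q\<close>.\<close>

lemma left_invariant_field_smooth:
  assumes d: "(U, \<phi>) \<in> At" "\<one>\<^bsub>G\<^esub> \<in> U"
  shows "smooth_vector_field At (left_invariant_field U \<phi> w)"
  unfolding smooth_vector_field_def
proof (intro conjI allI impI)
  let ?E = "left_invariant_field U \<phi> w" and ?e = "\<phi> \<one>\<^bsub>G\<^esub>"
  show "?E p \<in> tangent_space At p" for p
    using left_push_tangent[OF chart_vector_in_tangent_space[OF d], of p w]
    by (simp add: left_invariant_field_def mult_one)
  fix p f assume f: "smooth_near At p f"
  obtain V \<psi> where c: "(V, \<psi>) \<in> At" "p \<in> V" by (rule obtain_chart)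
  obtain M where M: "open M" "\<psi> p \<in> M" "M \<subseteq> \<psi> ` V" "smooth_on M (f \<circ> inv_into V \<psi>)"
    using f smooth_near_chart[OF c] by blast
  let ?m = "\<lambda>z. inv_into V \<psi> (fst z) \<otimes>\<^bsub>G\<^esub> inv_into U \<phi> (snd z)"
  define S where "S = {z \<in> \<psi> ` V \<times> \<phi> ` U. ?m z \<in> V}"
  have S: "open S" "smooth_on S (\<lambda>z. \<psi> (?m z))"
    using mult_chart[OF c(1) d(1) c(1)] unfolding S_def .
  \<comment> \<open>Shrinks the domain so that the product lands where \<open>f\<close> is known to
    be smooth.\<close>
  define S' where "S' = S \<inter> (\<lambda>z. \<psi> (?m z)) -` M"
  have S': "open S'"
    unfolding S'_def by (rule continuous_open_preimage[OF smooth_on_continuous[OF S(2)] S(1) M(1)])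
  define H where "H = (\<lambda>z. f (?m z))"
  have "smooth_on S' (\<lambda>z. (f \<circ> inv_into V \<psi>) (\<psi> (?m z)))"
    by (rule smooth_on_compose[OF S' M(1) _ smooth_on_subset[OF S(2)] M(4)]) (auto simp: S'_def)
  then have H: "smooth_on S' H"
    by (rule smooth_on_cong[OF S', rotated]) (auto simp: H_def S'_def S_def chart_inv[OF c(1)])
  define N where "N = (\<lambda>b. (b, ?e)) -` S'"
  have N: "open N"
    unfolding N_def by (rule open_vimage[OF S']) (intro continuous_intros)
  have pN: "\<psi> p \<in> N" and NV: "N \<subseteq> \<psi> ` V"
    using c d M(2) by (auto simp: N_def S'_def S_def chart_inv mult_one)
  have "smooth_on N (\<lambda>b. (b, 0) + (0, ?e))"
    by (intro smooth_on_add smooth_on_const smooth_on_linear N)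
      (intro bounded_linear_Pair bounded_linear_zero bounded_linear_ident)
  then have i: "smooth_on N (\<lambda>b. (b, ?e))" by simp
  have "smooth_on N (\<lambda>b. (\<lambda>z. D H z (0, w)) (b, ?e))"
    by (rule smooth_on_compose[OF N S' _ i smooth_on_D[OF H]]) (auto simp: N_def)
  moreover have "D H (b, ?e) (0, w) = ((\<lambda>q. ?E q f) \<circ> inv_into V \<psi>) b" if b: "b \<in> N" for b
  proof -
    define q where "q = inv_into V \<psi> b"
    have q: "q \<in> V" "\<psi> q = b" using chart_inv_in[OF subsetD[OF NV b]] chart_inv'[OF c(1) subsetD[OF NV b]] by (simp_all add: q_def)
    have "b \<in> M" using b q d by (auto simp: N_def S'_def chart_inv mult_one simp flip: q_def)
    then have "smooth_near At q f"
      unfolding smooth_near_chart[OF c(1) q(1)] using M q(2) by blast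
    then have sm: "smooth_near At \<one>\<^bsub>G\<^esub> (\<lambda>x. f (q \<otimes>\<^bsub>G\<^esub> x))"
      by (simp add: smooth_near_left_translation mult_one)
    have bS: "(b, ?e) \<in> S'" using b by (simp add: N_def)
    have "((\<lambda>c. H (b, c)) has_derivative (\<lambda>w. D H (b, ?e) (0, w))) (at ?e)"
      by (rule has_derivative_compose[of "\<lambda>c. (b, c)" "\<lambda>w. (0, w)" ?e UNIV H,
            OF _ smooth_on_has_derivative[OF S' H bS]])
        (auto intro!: derivative_eq_intros)
    moreover have "(\<lambda>c. H (b, c)) = (\<lambda>x. f (q \<otimes>\<^bsub>G\<^esub> x)) \<circ> inv_into U \<phi>"
      by (auto simp: H_def q_def)
    ultimately have "D ((\<lambda>x. f (q \<otimes>\<^bsub>G\<^esub> x)) \<circ> inv_into U \<phi>) ?e w = D H (b, ?e) (0, w)"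
      by (simp add: D_eqI)
    then show ?thesis
      using sm by (simp add: left_invariant_field_def left_push_def chart_vector_def flip: q_def)
  qed
  ultimately have "smooth_on N ((\<lambda>q. ?E q f) \<circ> inv_into V \<psi>)"
    by (rule smooth_on_cong[OF N, rotated])
  then show "smooth_near At p (\<lambda>q. ?E q f)"
    unfolding smooth_near_chart[OF c] using N pN NV by blast
qed

lemma lie_algebra_smooth: "X \<in> lie_algebra G At \<Longrightarrow> smooth_vector_field At X"
  by (simp add: lie_algebra_def)

lemma lie_algebra_left_push:
  "X \<in> lie_algebra G At \<Longrightarrow> X (a \<otimes>\<^bsub>G\<^esub> p) = left_push G a (X p)"
  by (simp add: lie_algebra_def)

lemma left_invariant_field_in_lie_algebra:
  assumes d: "(U, \<phi>) \<in> At" "\<one>\<^bsub>G\<^esub> \<in> U"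
  shows "left_invariant_field U \<phi> w \<in> lie_algebra G At"
  using left_invariant_field_smooth[OF assms]
  by (auto simp: lie_algebra_def left_invariant_field_def left_push_def mult_assoc)

lemma left_invariant_field_one: "left_invariant_field U \<phi> w \<one>\<^bsub>G\<^esub> = chart_vector At U \<phi> \<one>\<^bsub>G\<^esub> w"
  by (simp add: left_invariant_field_def left_push_def mult_one)

lemma lie_algebra_field_eqI:
  assumes "X \<in> lie_algebra G At" "Y \<in> lie_algebra G At" "X \<one>\<^bsub>G\<^esub> = Y \<one>\<^bsub>G\<^esub>"
  shows "X = Y"
proof
  fix a
  show "X a = Y a"
    using lie_algebra_left_push[OF assms(1), of a "\<one>\<^bsub>G\<^esub>"] lie_algebra_left_push[OF assms(2), of a "\<one>\<^bsub>G\<^esub>"]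
      assms(3) by (simp add: mult_one)
qed

text \<open>Makes the model space \<open>'a\<close> a coordinate space of the Lie algebra, so that
  dimension arguments can use \<open>DIM('a)\<close> instead of the type of all vector
  fields.\<close>

lemma lie_algebra_parametrization:
  "\<exists>E :: 'a \<Rightarrow> 'g vector_field. linear E \<and> inj E \<and> range E = lie_algebra G At"
proof -
  obtain U \<phi> where d: "(U, \<phi>) \<in> At" "\<one>\<^bsub>G\<^esub> \<in> U" by (rule obtain_chart)
  let ?E = "left_invariant_field U \<phi>"
  have "linear ?E"
    by (rule linearI) (auto simp: left_invariant_field_def left_push_def fun_eq_iff scaleR_fun_def
        chart_vector_add[OF d] chart_vector_scaleR[OF d])
  moreover have "inj ?E"
    by (rule injI) (metis chart_vector_inject[OF d] left_invariant_field_one)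
  moreover have "X \<in> range ?E" if X: "X \<in> lie_algebra G At" for X
  proof -
    obtain w where "X \<one>\<^bsub>G\<^esub> = chart_vector At U \<phi> \<one>\<^bsub>G\<^esub> w"
      using smooth_vf_tangent[OF lie_algebra_smooth[OF X]] tangent_space_chart[OF d] by blast
    then have "X = ?E w"
      by (intro lie_algebra_field_eqI X left_invariant_field_in_lie_algebra d)
        (simp add: left_invariant_field_one)
    then show ?thesis by blast
  qed
  ultimately show ?thesis
    using left_invariant_field_in_lie_algebra[OF d] by blast
qed

lemma lie_algebra_field_bracket:
  assumes X: "X \<in> lie_algebra G At" and Y: "Y \<in> lie_algebra G At"
  shows "field_bracket At X Y \<in> lie_algebra G At"
proof -
  have "field_bracket At X Y (a \<otimes>\<^bsub>G\<^esub> p) = left_push G a (field_bracket At X Y p)" for a p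
    by (auto simp: field_bracket_def left_push_def fun_eq_iff smooth_near_left_translation
        lie_algebra_left_push[OF X] lie_algebra_left_push[OF Y])
  then show ?thesis
    using field_bracket_smooth[OF lie_algebra_smooth[OF X] lie_algebra_smooth[OF Y]]
    by (simp add: lie_algebra_def)
qed

end

section \<open>Lie brackets on eight-dimensional spaces\<close>

lemma exhaust_8:
  fixes x :: 8
  shows "x = 1 \<or> x = 2 \<or> x = 3 \<or> x = 4 \<or> x = 5 \<or> x = 6 \<or> x = 7 \<or> x = 8"
proof (induct x)
  case (of_int z)
  then have "0 \<le> z" and "z < 8" by simp_all
  then have "z = 0 \<or> z = 1 \<or> z = 2 \<or> z = 3 \<or> z = 4 \<or> z = 5 \<or> z = 6 \<or> z = 7" by arith
  then show ?case by auto
qed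

lemma forall_8:
  "(\<forall>i::8. P i) \<longleftrightarrow> P 1 \<and> P 2 \<and> P 3 \<and> P 4 \<and> P 5 \<and> P 6 \<and> P 7 \<and> P 8"
  by (metis exhaust_8)

lemma UNIV_8: "UNIV = {1, 2, 3, 4, 5, 6, 7, 8 :: 8}"
  using exhaust_8 by auto

lemma sum_8: "sum f (UNIV :: 8 set) = f 1 + f 2 + f 3 + f 4 + f 5 + f 6 + f 7 + f 8"
  unfolding UNIV_8 by (simp add: ac_simps)

lemmas vec8_eq_iff = vec_eq_iff[where 'b = 8, unfolded forall_8]

lemma linear_expansion_8:
  fixes f :: "real^8 \<Rightarrow> 'v::real_vector"
  assumes "linear f"
  shows "f v = v$1 *\<^sub>R f (axis 1 1) + v$2 *\<^sub>R f (axis 2 1) + v$3 *\<^sub>R f (axis 3 1) + v$4 *\<^sub>R f (axis 4 1)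
    + v$5 *\<^sub>R f (axis 5 1) + v$6 *\<^sub>R f (axis 6 1) + v$7 *\<^sub>R f (axis 7 1) + v$8 *\<^sub>R f (axis 8 1)"
proof -
  have "f v = f (\<Sum>i\<in>UNIV. v$i *\<^sub>R axis i 1)"
    using basis_expansion[of v] by (simp add: scalar_mult_eq_scaleR)
  then show ?thesis by (simp add: linear_sum[OF assms] linear_scale[OF assms] linear_add[OF assms] sum_8)
qed

lemma lie_bracket_bilinear: "lie_bracket br \<Longrightarrow> bilinear br"
  by (simp add: lie_bracket_def)

lemma lie_bracket_self: "lie_bracket br \<Longrightarrow> br x x = 0"
  by (simp add: lie_bracket_def)

lemma lie_bracket_jacobi:
  "lie_bracket br \<Longrightarrow> br x (br y z) + br y (br z x) + br z (br x y) = 0"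
  by (simp add: lie_bracket_def)

lemma lie_bracket_skew:
  assumes "lie_bracket br" shows "br y x = - br x y"
proof -
  have "br (x + y) (x + y) = 0" "br x x = 0" "br y y = 0"
    using assms lie_bracket_self by blast+
  then have "br x y + br y x = 0"
    using assms by (simp add: bilinear_ladd bilinear_radd lie_bracket_bilinear)
  then show ?thesis by (simp add: add_eq_0_iff)
qed

text \<open>The Jacobi identity as the statement that bracketing on the right with \<open>z\<close>
  is a derivation, matching relations that have \<open>X\<close> and \<open>Y\<close> on the right.
  Read for \<open>x\<close> and \<open>y\<close> instead, it says that bracketing on the left is a
  representation.\<close>

lemma lie_bracket_derivation:
  assumes "lie_bracket br"
  shows "br (br x y) z = br (br x z) y + br x (br y z)"
proof -
  have "br (br x z) y = - br y (br x z)" "br y (br x z) = - br y (br z x)"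
      "br (br x y) z = - br z (br x y)"
    using lie_bracket_skew[OF assms] bilinear_rneg[OF lie_bracket_bilinear[OF assms]] by metis+
  moreover have "br x (br y z) + br y (br z x) = - br z (br x y)"
    using lie_bracket_jacobi[OF assms, of x y z] eq_neg_iff_add_eq_0 by blast
  ultimately show ?thesis by (simp add: add.commute)
qed

lemmas bilinear_simps = bilinear_ladd bilinear_radd bilinear_lmul bilinear_rmul bilinear_lneg
  bilinear_rneg bilinear_lsub bilinear_rsub bilinear_lzero bilinear_rzero

text \<open>With \<open>p\<close>, \<open>s\<close>, \<open>k\<close> the coordinates in which the trace form of \<open>sl\<^sub>2(\<real>)\<close> is \<open>p\<^sup>2 + s\<^sup>2 - k\<^sup>2\<close>, expanding
  the determinant of the three coordinate vectors along its columns shows that the sum of the \<open>k\<^sup>2\<close>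
  equals both minus the sum of the \<open>p\<^sup>2\<close> and minus the sum of the \<open>s\<^sup>2\<close>.\<close>

lemma su2_two_dim_rep_traceless_trivial:
  fixes p1 :: real
  assumes "p3 = k1 * s2 - s1 * k2" "s3 = p1 * k2 - p2 * k1" "k3 = p1 * s2 - p2 * s1"
    and "p2 = k3 * s1 - s3 * k1" "s2 = p3 * k1 - p1 * k3" "k2 = p3 * s1 - p1 * s3"
    and "p1 = k2 * s3 - s2 * k3" "s1 = p2 * k3 - p3 * k2" "k1 = p2 * s3 - p3 * s2"
  shows "p1 = 0 \<and> p2 = 0 \<and> p3 = 0 \<and> s1 = 0 \<and> s2 = 0 \<and> s3 = 0 \<and> k1 = 0 \<and> k2 = 0 \<and> k3 = 0"
proof -
  let ?d = "p1 * (s2 * k3 - s3 * k2) + p2 * (s3 * k1 - s1 * k3) + p3 * (s1 * k2 - s2 * k1)"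
  have "p1 * p1 + p2 * p2 + p3 * p3 =
      p1 * (k2 * s3 - s2 * k3) + p2 * (k3 * s1 - s3 * k1) + p3 * (k1 * s2 - s1 * k2)"
    by (simp flip: assms)
  also have "\<dots> = - ?d" by (simp add: algebra_simps)
  finally have p: "p1 * p1 + p2 * p2 + p3 * p3 = - ?d" .
  have "s1 * s1 + s2 * s2 + s3 * s3 =
      s1 * (p2 * k3 - p3 * k2) + s2 * (p3 * k1 - p1 * k3) + s3 * (p1 * k2 - p2 * k1)"
    by (simp flip: assms)
  also have "\<dots> = - ?d" by (simp add: algebra_simps)
  finally have s: "s1 * s1 + s2 * s2 + s3 * s3 = - ?d" .
  have "k1 * k1 + k2 * k2 + k3 * k3 =
      k1 * (p2 * s3 - p3 * s2) + k2 * (p3 * s1 - p1 * s3) + k3 * (p1 * s2 - p2 * s1)"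
    by (simp flip: assms)
  also have "\<dots> = ?d" by (simp add: algebra_simps)
  finally have k: "k1 * k1 + k2 * k2 + k3 * k3 = ?d" .
  have nn: "0 \<le> p1 * p1" "0 \<le> p2 * p2" "0 \<le> p3 * p3" "0 \<le> s1 * s1" "0 \<le> s2 * s2" "0 \<le> s3 * s3"
    "0 \<le> k1 * k1" "0 \<le> k2 * k2" "0 \<le> k3 * k3" by simp_all
  have "p1 * p1 = 0" "p2 * p2 = 0" "p3 * p3 = 0" "s1 * s1 = 0" "s2 * s2 = 0" "s3 * s3 = 0"
    "k1 * k1 = 0" "k2 * k2 = 0" "k3 * k3 = 0"
    using p s k nn by linarith+
  then show ?thesis by simp
qed

text \<open>The hypotheses are the entries of \<open>[a, b] = 2 c\<close>,
  \<open>[c, a] = 2 b\<close>, \<open>[b, c] = 2 a\<close> for real 2x2 matrices. Commutators have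
  trace zero, which reduces the claim to the traceless case.\<close>

lemma su2_two_dim_rep_trivial:
  fixes a11 :: real
  assumes ab: "a12 * b21 - b12 * a21 = 2 * c11"
      "a11 * b12 + a12 * b22 - (b11 * a12 + b12 * a22) = 2 * c12"
      "a21 * b11 + a22 * b21 - (b21 * a11 + b22 * a21) = 2 * c21"
      "a21 * b12 - b21 * a12 = 2 * c22"
    and ca: "c12 * a21 - a12 * c21 = 2 * b11"
      "c11 * a12 + c12 * a22 - (a11 * c12 + a12 * c22) = 2 * b12"
      "c21 * a11 + c22 * a21 - (a21 * c11 + a22 * c21) = 2 * b21"
      "c21 * a12 - a21 * c12 = 2 * b22"
    and bc: "b12 * c21 - c12 * b21 = 2 * a11"
      "b11 * c12 + b12 * c22 - (c11 * b12 + c12 * b22) = 2 * a12"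
      "b21 * c11 + b22 * c21 - (c21 * b11 + c22 * b21) = 2 * a21"
      "b21 * c12 - c21 * b12 = 2 * a22"
  shows "a11 = 0 \<and> a12 = 0 \<and> a21 = 0 \<and> a22 = 0 \<and> b11 = 0 \<and> b12 = 0 \<and> b21 = 0 \<and> b22 = 0
    \<and> c11 = 0 \<and> c12 = 0 \<and> c21 = 0 \<and> c22 = 0"
proof -
  have t: "a22 = - a11" "b22 = - b11" "c22 = - c11"
    using ab(1,4) ca(1,4) bc(1,4) by (simp_all add: algebra_simps)
  \<comment> \<open>Symmetric and skew parts of the off-diagonal entries; the diagonal entries
    \<open>a11\<close>, \<open>b11\<close>, \<open>c11\<close> are the coordinates
    \<open>p1\<close>, \<open>p2\<close>, \<open>p3\<close>.\<close>
  define s1 k1 s2 k2 s3 k3 where sk: "s1 = (a12 + a21) / 2" "k1 = (a12 - a21) / 2"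
    "s2 = (b12 + b21) / 2" "k2 = (b12 - b21) / 2" "s3 = (c12 + c21) / 2" "k3 = (c12 - c21) / 2"
  have e: "a12 = s1 + k1" "a21 = s1 - k1" "b12 = s2 + k2" "b21 = s2 - k2" "c12 = s3 + k3" "c21 = s3 - k3"
    by (simp_all add: sk field_simps)
  have "a11 = 0 \<and> b11 = 0 \<and> c11 = 0 \<and> s1 = 0 \<and> s2 = 0 \<and> s3 = 0 \<and> k1 = 0 \<and> k2 = 0 \<and> k3 = 0"
    by (rule su2_two_dim_rep_traceless_trivial; use ab ca bc in \<open>simp add: t e algebra_simps\<close>)
  then show ?thesis by (simp add: t e)
qed

text \<open>Since \<open>a\<close>, \<open>b\<close>, \<open>c\<close> map the first six axes into
  their span, coordinates 7 and 8 of \<open>br u v\<close> depend only on those of \<open>v\<close>.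
  The resulting 2x2 matrices form a representation of su(2) on the quotient, which is
  trivial.\<close>

lemma su2_acts_trivially:
  fixes br :: "real^8 \<Rightarrow> real^8 \<Rightarrow> real^8"
  assumes br: "lie_bracket br"
    and rel: "br a b = 2 *\<^sub>R c" "br c a = 2 *\<^sub>R b" "br b c = 2 *\<^sub>R a"
    and k: "\<And>u i j. u \<in> {a, b, c} \<Longrightarrow> i \<in> {1, 2, 3, 4, 5, 6} \<Longrightarrow> j \<in> {7, 8} \<Longrightarrow> br u (axis i 1) $ j = 0"
    and u: "u \<in> {a, b, c}" and i: "i \<in> {7, 8}" and j: "j \<in> {7, 8}"
  shows "br u (axis i 1) $ j = 0"
proof -
  note bl = lie_bracket_bilinear[OF br]
  have ex: "br u v $ j = br u (axis 7 1) $ j * v $ 7 + br u (axis 8 1) $ j * v $ 8"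
    if "u \<in> {a, b, c}" "j \<in> {7, 8}" for u v j
  proof -
    have "linear (br u)" using bl by (simp add: bilinear_def)
    then show ?thesis
      using k[OF that(1) _ that(2)] by (subst linear_expansion_8[of "br u"]) simp_all
  qed
  have com: "br x (br y z) $ j - br y (br x z) $ j = 2 * br w z $ j"
    if "br x y = 2 *\<^sub>R w" for x y w z j
    using lie_bracket_derivation[OF br, of x y z] lie_bracket_skew[OF br, of y "br x z"] that bl
    by (simp add: bilinear_lmul vec_eq_iff)
  have eq: "(br x (axis 7 1) $ j * br y (axis i 1) $ 7 + br x (axis 8 1) $ j * br y (axis i 1) $ 8)
     - (br y (axis 7 1) $ j * br x (axis i 1) $ 7 + br y (axis 8 1) $ j * br x (axis i 1) $ 8)
     = 2 * br w (axis i 1) $ j"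
    if "br x y = 2 *\<^sub>R w" "x \<in> {a, b, c}" "y \<in> {a, b, c}" "j \<in> {7, 8}" for x y w i j
    using com[OF that(1), of "axis i 1" j] ex[OF that(2,4), of "br y (axis i 1)"]
      ex[OF that(3,4), of "br x (axis i 1)"] by simp
  note E = eq[where j = 7 and i = 7] eq[where j = 7 and i = 8] eq[where j = 8 and i = 7] eq[where j = 8 and i = 8]
  have "br a (axis 7 1) $ 7 = 0 \<and> br a (axis 8 1) $ 7 = 0 \<and> br a (axis 7 1) $ 8 = 0 \<and> br a (axis 8 1) $ 8 = 0 \<and>
    br b (axis 7 1) $ 7 = 0 \<and> br b (axis 8 1) $ 7 = 0 \<and> br b (axis 7 1) $ 8 = 0 \<and> br b (axis 8 1) $ 8 = 0 \<and>
    br c (axis 7 1) $ 7 = 0 \<and> br c (axis 8 1) $ 7 = 0 \<and> br c (axis 7 1) $ 8 = 0 \<and> br c (axis 8 1) $ 8 = 0"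
    by (rule su2_two_dim_rep_trivial; use E[OF rel(1)] E[OF rel(2)] E[OF rel(3)] in \<open>simp add: algebra_simps\<close>)
  then show ?thesis using u i j by auto
qed

section \<open>The action of m on k and the bracket of X and Y\<close>

lemma su2_su2_bracket_table:
  assumes br: "lie_bracket br" and rel: "su2_su2_relations br a b c r s t"
  shows "br a b = 2 *\<^sub>R c" "br b a = - (2 *\<^sub>R c)" "br c a = 2 *\<^sub>R b" "br a c = - (2 *\<^sub>R b)"
    "br b c = 2 *\<^sub>R a" "br c b = - (2 *\<^sub>R a)"
    "br r s = 2 *\<^sub>R t" "br s r = - (2 *\<^sub>R t)" "br t r = 2 *\<^sub>R s" "br r t = - (2 *\<^sub>R s)"
    "br s t = 2 *\<^sub>R r" "br t s = - (2 *\<^sub>R r)"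
    "br a r = 0" "br a s = 0" "br a t = 0" "br b r = 0" "br b s = 0" "br b t = 0"
    "br c r = 0" "br c s = 0" "br c t = 0"
    "br r a = 0" "br s a = 0" "br t a = 0" "br r b = 0" "br s b = 0" "br t b = 0"
    "br r c = 0" "br s c = 0" "br t c = 0"
  using rel lie_bracket_skew[OF br, of b a] lie_bracket_skew[OF br, of a c] lie_bracket_skew[OF br, of c b]
    lie_bracket_skew[OF br, of s r] lie_bracket_skew[OF br, of r t] lie_bracket_skew[OF br, of t s]
    lie_bracket_skew[OF br, of r a] lie_bracket_skew[OF br, of s a] lie_bracket_skew[OF br, of t a]
    lie_bracket_skew[OF br, of r b] lie_bracket_skew[OF br, of s b] lie_bracket_skew[OF br, of t b]
    lie_bracket_skew[OF br, of r c] lie_bracket_skew[OF br, of s c] lie_bracket_skew[OF br, of t c]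
  by (simp_all add: su2_su2_relations_def)

abbreviation (input) "e8 i \<equiv> axis i 1 :: real^8"

lemma e8_nth: "e8 i $ j = (if i = j then 1 else 0)"
  by (simp add: axis_def)

text \<open>Hypothesis \<open>x\<close> makes right bracketing with the vector \<open>x\<close> a
  derivation \<open>d\<close> of \<open>k\<close>. Each copy of su(2) is an ideal of
  \<open>k\<close> spanned by its own brackets, so \<open>d\<close> preserves it; comparing
  coefficients then shows that \<open>d\<close> is skew.\<close>

lemma su2_su2_derivation:
  fixes br :: "real^8 \<Rightarrow> real^8 \<Rightarrow> real^8"
  assumes br: "lie_bracket br"
    and rel: "su2_su2_relations br (e8 1) (e8 2) (e8 3) (e8 4) (e8 5) (e8 6)"
    and x: "\<And>i j. i \<in> {1, 2, 3, 4, 5, 6} \<Longrightarrow> j \<in> {7, 8} \<Longrightarrow> br (e8 i) x $ j = 0"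
  shows "\<exists>p q r. br (e8 1) x = - p *\<^sub>R e8 2 - q *\<^sub>R e8 3 \<and> br (e8 2) x = p *\<^sub>R e8 1 - r *\<^sub>R e8 3
      \<and> br (e8 3) x = q *\<^sub>R e8 1 + r *\<^sub>R e8 2"
    and "\<exists>p q r. br (e8 4) x = - p *\<^sub>R e8 5 - q *\<^sub>R e8 6 \<and> br (e8 5) x = p *\<^sub>R e8 4 - r *\<^sub>R e8 6
      \<and> br (e8 6) x = q *\<^sub>R e8 4 + r *\<^sub>R e8 5"
proof -
  note tab = su2_su2_bracket_table[OF br rel] and bl = lie_bracket_bilinear[OF br]
  define d where "d = (\<lambda>i. br (e8 i) x)"
  then have dx: "br (e8 i) x = d i" for i by simp
  have d78: "d i $ 7 = 0" "d i $ 8 = 0" if "i \<in> {1, 2, 3, 4, 5, 6}" for i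
    using x that by (auto simp: d_def)
  have lin: "linear (br y)" for y using bl by (simp add: bilinear_def)
  have ad: "br (e8 1) v = (2 * v$2) *\<^sub>R e8 3 - (2 * v$3) *\<^sub>R e8 2"
      "br (e8 2) v = (2 * v$3) *\<^sub>R e8 1 - (2 * v$1) *\<^sub>R e8 3"
      "br (e8 3) v = (2 * v$1) *\<^sub>R e8 2 - (2 * v$2) *\<^sub>R e8 1"
      "br (e8 4) v = (2 * v$5) *\<^sub>R e8 6 - (2 * v$6) *\<^sub>R e8 5"
      "br (e8 5) v = (2 * v$6) *\<^sub>R e8 4 - (2 * v$4) *\<^sub>R e8 6"
      "br (e8 6) v = (2 * v$4) *\<^sub>R e8 5 - (2 * v$5) *\<^sub>R e8 4" if "v $ 7 = 0" "v $ 8 = 0" for v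
    by (subst linear_expansion_8[OF lin], simp add: tab lie_bracket_self[OF br] that mult.commute)+
  have der: "2 *\<^sub>R d k = br (e8 i) (d j) - br (e8 j) (d i)" if "br (e8 i) (e8 j) = 2 *\<^sub>R e8 k" for i j k
    using lie_bracket_derivation[OF br, of "e8 i" "e8 j" x] lie_bracket_skew[OF br, of "e8 j" "d i"]
    by (simp add: that d_def bilinear_lmul[OF bl])
  have D: "2 *\<^sub>R d 3 = br (e8 1) (d 2) - br (e8 2) (d 1)" "2 *\<^sub>R d 2 = br (e8 3) (d 1) - br (e8 1) (d 3)"
      "2 *\<^sub>R d 1 = br (e8 2) (d 3) - br (e8 3) (d 2)" "2 *\<^sub>R d 6 = br (e8 4) (d 5) - br (e8 5) (d 4)"
      "2 *\<^sub>R d 5 = br (e8 6) (d 4) - br (e8 4) (d 6)" "2 *\<^sub>R d 4 = br (e8 5) (d 6) - br (e8 6) (d 5)"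
    by (rule der, simp add: tab)+
  have D': "d 1 $ 1 = 0 \<and> d 1 $ 4 = 0 \<and> d 1 $ 5 = 0 \<and> d 1 $ 6 = 0 \<and>
      d 2 $ 1 = - d 1 $ 2 \<and> d 2 $ 2 = 0 \<and> d 2 $ 4 = 0 \<and> d 2 $ 5 = 0 \<and> d 2 $ 6 = 0 \<and>
      d 3 $ 1 = - d 1 $ 3 \<and> d 3 $ 2 = - d 2 $ 3 \<and> d 3 $ 3 = 0 \<and> d 3 $ 4 = 0 \<and> d 3 $ 5 = 0 \<and> d 3 $ 6 = 0"
    using D(1-3)[unfolded vec8_eq_iff] by (simp add: ad[OF d78] e8_nth)
  have D'': "d 4 $ 4 = 0 \<and> d 4 $ 1 = 0 \<and> d 4 $ 2 = 0 \<and> d 4 $ 3 = 0 \<and>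
      d 5 $ 4 = - d 4 $ 5 \<and> d 5 $ 5 = 0 \<and> d 5 $ 1 = 0 \<and> d 5 $ 2 = 0 \<and> d 5 $ 3 = 0 \<and>
      d 6 $ 4 = - d 4 $ 6 \<and> d 6 $ 5 = - d 5 $ 6 \<and> d 6 $ 6 = 0 \<and> d 6 $ 1 = 0 \<and> d 6 $ 2 = 0 \<and> d 6 $ 3 = 0"
    using D(4-6)[unfolded vec8_eq_iff] by (simp add: ad[OF d78] e8_nth)
  \<comment> \<open>The free parameters are the entries of \<open>d\<close> above the diagonal,
    negated to fit the sign convention of the relations.\<close>
  have "br (e8 1) x = - (- d 1 $ 2) *\<^sub>R e8 2 - (- d 1 $ 3) *\<^sub>R e8 3 \<and> br (e8 2) x = (- d 1 $ 2) *\<^sub>R e8 1 - (- d 2 $ 3) *\<^sub>R e8 3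
      \<and> br (e8 3) x = (- d 1 $ 3) *\<^sub>R e8 1 + (- d 2 $ 3) *\<^sub>R e8 2"
    using D' by (simp add: vec8_eq_iff e8_nth d78 dx)
  then show "\<exists>p q r. br (e8 1) x = - p *\<^sub>R e8 2 - q *\<^sub>R e8 3 \<and> br (e8 2) x = p *\<^sub>R e8 1 - r *\<^sub>R e8 3
      \<and> br (e8 3) x = q *\<^sub>R e8 1 + r *\<^sub>R e8 2" by blast
  have "br (e8 4) x = - (- d 4 $ 5) *\<^sub>R e8 5 - (- d 4 $ 6) *\<^sub>R e8 6 \<and> br (e8 5) x = (- d 4 $ 5) *\<^sub>R e8 4 - (- d 5 $ 6) *\<^sub>R e8 6
      \<and> br (e8 6) x = (- d 4 $ 6) *\<^sub>R e8 4 + (- d 5 $ 6) *\<^sub>R e8 5"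
    using D'' by (simp add: vec8_eq_iff e8_nth d78 dx)
  then show "\<exists>p q r. br (e8 4) x = - p *\<^sub>R e8 5 - q *\<^sub>R e8 6 \<and> br (e8 5) x = p *\<^sub>R e8 4 - r *\<^sub>R e8 6
      \<and> br (e8 6) x = q *\<^sub>R e8 4 + r *\<^sub>R e8 5" by blast
qed

lemma bracket_relations_adapted:
  fixes br :: "real^8 \<Rightarrow> real^8 \<Rightarrow> real^8"
  assumes br: "lie_bracket br"
    and rel: "su2_su2_relations br (e8 1) (e8 2) (e8 3) (e8 4) (e8 5) (e8 6)"
    and z8: "br (e8 7) (e8 8) $ 8 = 0"
  shows "\<exists>b11 b21 c11 c12 c21 c22 s14 s24 t14 t15 t24 t25 \<rho>.
    bracket_relations br (e8 1) (e8 2) (e8 3) (e8 4) (e8 5) (e8 6) (e8 7) (e8 8)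
      b11 b21 c11 c12 c21 c22 s14 s24 t14 t15 t24 t25 \<rho>"
proof -
  note tab = su2_su2_bracket_table[OF br rel] and bl = lie_bracket_bilinear[OF br]
  have lin: "linear (br y)" for y using bl by (simp add: bilinear_def)
  have k: "br (e8 u) (e8 i) $ j = 0" if "u \<in> {1, 2, 3, 4, 5, 6}" "i \<in> {1, 2, 3, 4, 5, 6}" "j \<in> {7, 8}" for u i j
    using that by (auto simp: tab lie_bracket_self[OF br] e8_nth)
  have "br u (e8 i) $ j = 0" if "u \<in> {e8 1, e8 2, e8 3}" "i \<in> {7, 8}" "j \<in> {7, 8}" for u i j
    by (rule su2_acts_trivially[OF br tab(1,3,5) _ that]) (use k in auto)
  moreover have "br u (e8 i) $ j = 0" if "u \<in> {e8 4, e8 5, e8 6}" "i \<in> {7, 8}" "j \<in> {7, 8}" for u i j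
    by (rule su2_acts_trivially[OF br tab(7,9,11) _ that]) (use k in auto)
  ultimately have m: "br (e8 u) (e8 i) $ j = 0" if "i \<in> {7, 8}" "u \<in> {1, 2, 3, 4, 5, 6}" "j \<in> {7, 8}" for u i j
    using that by auto
  obtain b11 c11 c12 where X1: "br (e8 1) (e8 7) = - b11 *\<^sub>R e8 2 - c11 *\<^sub>R e8 3"
      "br (e8 2) (e8 7) = b11 *\<^sub>R e8 1 - c12 *\<^sub>R e8 3" "br (e8 3) (e8 7) = c11 *\<^sub>R e8 1 + c12 *\<^sub>R e8 2"
    using su2_su2_derivation(1)[OF br rel m[of 7]] by auto
  obtain b21 c21 c22 where Y1: "br (e8 1) (e8 8) = - b21 *\<^sub>R e8 2 - c21 *\<^sub>R e8 3"
      "br (e8 2) (e8 8) = b21 *\<^sub>R e8 1 - c22 *\<^sub>R e8 3" "br (e8 3) (e8 8) = c21 *\<^sub>R e8 1 + c22 *\<^sub>R e8 2"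
    using su2_su2_derivation(1)[OF br rel m[of 8]] by auto
  obtain s14 t14 t15 where X2: "br (e8 4) (e8 7) = - s14 *\<^sub>R e8 5 - t14 *\<^sub>R e8 6"
      "br (e8 5) (e8 7) = s14 *\<^sub>R e8 4 - t15 *\<^sub>R e8 6" "br (e8 6) (e8 7) = t14 *\<^sub>R e8 4 + t15 *\<^sub>R e8 5"
    using su2_su2_derivation(2)[OF br rel m[of 7]] by auto
  obtain s24 t24 t25 where Y2: "br (e8 4) (e8 8) = - s24 *\<^sub>R e8 5 - t24 *\<^sub>R e8 6"
      "br (e8 5) (e8 8) = s24 *\<^sub>R e8 4 - t25 *\<^sub>R e8 6" "br (e8 6) (e8 8) = t24 *\<^sub>R e8 4 + t25 *\<^sub>R e8 5"
    using su2_su2_derivation(2)[OF br rel m[of 8]] by auto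
  note XY = X1 Y1 X2 Y2
  define z where "z = br (e8 7) (e8 8)"
  define \<rho> where "\<rho> = z $ 7"
  have z: "z $ 7 = \<rho>" "z $ 8 = 0" using z8 by (simp_all add: \<rho>_def z_def)
  \<comment> \<open>The action of \<open>z\<close> on \<open>k\<close> is known from those of
    \<open>X\<close> and \<open>Y\<close>. Since su(2) has trivial centre, this determines the
    \<open>k\<close>-component of \<open>z\<close> once its other component \<open>\<rho>\<close> is
    fixed.\<close>
  have der: "br (e8 i) z = br (br (e8 i) (e8 7)) (e8 8) - br (br (e8 i) (e8 8)) (e8 7)" for i
    using lie_bracket_derivation[OF br, of "e8 i" "e8 7" "e8 8"] by (simp add: z_def)
  have ex: "br (e8 i) z = z$1 *\<^sub>R br (e8 i) (e8 1) + z$2 *\<^sub>R br (e8 i) (e8 2) + z$3 *\<^sub>R br (e8 i) (e8 3) +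
      z$4 *\<^sub>R br (e8 i) (e8 4) + z$5 *\<^sub>R br (e8 i) (e8 5) + z$6 *\<^sub>R br (e8 i) (e8 6) + \<rho> *\<^sub>R br (e8 i) (e8 7)" for i
    by (subst linear_expansion_8[OF lin]) (simp add: z)
  note E = ex[unfolded der]
  \<comment> \<open>For each unknown, the axis and coordinate are chosen so that it is the only
    unknown left, with coefficient 2 or -2: here \<open>[B, A] = - 2 C\<close> is read off at
    \<open>C\<close>.\<close>
  have "z$1 = 1/2 * (- \<rho> * c12 + b11 * c21 - b21 * c11)"
    using arg_cong[OF E[of 2], of "\<lambda>v. v $ 3"]
    by (simp add: tab XY lie_bracket_self[OF br] bilinear_simps[OF bl] e8_nth algebra_simps)
  moreover have "z$2 = 1/2 * (\<rho> * c11 + b11 * c22 - b21 * c12)"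
    using arg_cong[OF E[of 1], of "\<lambda>v. v $ 3"]
    by (simp add: tab XY lie_bracket_self[OF br] bilinear_simps[OF bl] e8_nth algebra_simps)
  moreover have "z$3 = 1/2 * (- \<rho> * b11 + c11 * c22 - c12 * c21)"
    using arg_cong[OF E[of 1], of "\<lambda>v. v $ 2"]
    by (simp add: tab XY lie_bracket_self[OF br] bilinear_simps[OF bl] e8_nth algebra_simps)
  moreover have "z$4 = 1/2 * (- \<rho> * t15 + s14 * t24 - s24 * t14)"
    using arg_cong[OF E[of 5], of "\<lambda>v. v $ 6"]
    by (simp add: tab XY lie_bracket_self[OF br] bilinear_simps[OF bl] e8_nth algebra_simps)
  moreover have "z$5 = 1/2 * (\<rho> * t14 + s14 * t25 - s24 * t15)"
    using arg_cong[OF E[of 4], of "\<lambda>v. v $ 6"]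
    by (simp add: tab XY lie_bracket_self[OF br] bilinear_simps[OF bl] e8_nth algebra_simps)
  moreover have "z$6 = 1/2 * (- \<rho> * s14 + t14 * t25 - t15 * t24)"
    using arg_cong[OF E[of 4], of "\<lambda>v. v $ 5"]
    by (simp add: tab XY lie_bracket_self[OF br] bilinear_simps[OF bl] e8_nth algebra_simps)
  ultimately have "br (e8 7) (e8 8) = \<rho> *\<^sub>R e8 7
      + (1/2 * (- \<rho> * c12 + b11 * c21 - b21 * c11)) *\<^sub>R e8 1
      + (1/2 * (\<rho> * c11 + b11 * c22 - b21 * c12)) *\<^sub>R e8 2
      + (1/2 * (- \<rho> * b11 + c11 * c22 - c12 * c21)) *\<^sub>R e8 3
      + (1/2 * (- \<rho> * t15 + s14 * t24 - s24 * t14)) *\<^sub>R e8 4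
      + (1/2 * (\<rho> * t14 + s14 * t25 - s24 * t15)) *\<^sub>R e8 5
      + (1/2 * (- \<rho> * s14 + t14 * t25 - t15 * t24)) *\<^sub>R e8 6"
    using z by (simp add: vec8_eq_iff e8_nth flip: z_def)
  then have "bracket_relations br (e8 1) (e8 2) (e8 3) (e8 4) (e8 5) (e8 6) (e8 7) (e8 8)
      b11 b21 c11 c12 c21 c22 s14 s24 t14 t15 t24 t25 \<rho>"
    unfolding bracket_relations_def using rel XY by blast
  then show ?thesis by blast
qed

section \<open>Existence and uniqueness of the bracket\<close>

text \<open>Replacing \<open>X\<close>, \<open>Y\<close> by the elements \<open>X - u - u'\<close>, \<open>Y - w - w'\<close> that centralize both copies of
  \<open>su(2)\<close> (realized as \<open>\<real>\<^sup>3\<close> with twice the cross product) turns the bracket into a direct product.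
  \<open>straighten\<close> is a coordinate of this change of basis.\<close>

definition straighten :: "real^3 \<Rightarrow> real^3 \<Rightarrow> 8 \<Rightarrow> 8 \<Rightarrow> 8 \<Rightarrow> real^8 \<Rightarrow> real^3"
  where "straighten u w i j k x = vector [x$i, x$j, x$k] + x$7 *\<^sub>R u + x$8 *\<^sub>R w"

text \<open>There is no \<open>e8 8\<close> term because it only has to express brackets, which have
  no \<open>Y\<close>-component.\<close>

definition unstraighten :: "real^3 \<Rightarrow> real^3 \<Rightarrow> real \<Rightarrow> real^8"
  where "unstraighten p q a = p$1 *\<^sub>R e8 1 + p$2 *\<^sub>R e8 2 + p$3 *\<^sub>R e8 3
    + q$1 *\<^sub>R e8 4 + q$2 *\<^sub>R e8 5 + q$3 *\<^sub>R e8 6 + a *\<^sub>R e8 7"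

text \<open>In the direct product the two-dimensional factor contributes \<open>d\<close> times the
  centralizing element \<open>X - u - u'\<close>. The subtracted multiples of \<open>u\<close> and
  \<open>u'\<close> express this element in the original basis.\<close>

definition twisted_product_bracket ::
    "real^3 \<Rightarrow> real^3 \<Rightarrow> real^3 \<Rightarrow> real^3 \<Rightarrow> real \<Rightarrow> real^8 \<Rightarrow> real^8 \<Rightarrow> real^8"
  where "twisted_product_bracket u w u' w' \<rho> x y =
    (let P = straighten u w 1 2 3; Q = straighten u' w' 4 5 6; d = \<rho> * (x$7 * y$8 - x$8 * y$7) in
     unstraighten (2 *\<^sub>R cross3 (P x) (P y) - d *\<^sub>R u) (2 *\<^sub>R cross3 (Q x) (Q y) - d *\<^sub>R u') d)"

lemma straighten_add: "straighten u w i j k (x + y) = straighten u w i j k x + straighten u w i j k y"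
  and straighten_scaleR: "straighten u w i j k (c *\<^sub>R x) = c *\<^sub>R straighten u w i j k x"
  by (simp_all add: straighten_def vec_eq_iff forall_3 algebra_simps)

lemma unstraighten_add: "unstraighten p q a + unstraighten p' q' a' = unstraighten (p + p') (q + q') (a + a')"
  and unstraighten_scaleR: "c *\<^sub>R unstraighten p q a = unstraighten (c *\<^sub>R p) (c *\<^sub>R q) (c * a)"
  by (simp_all add: unstraighten_def algebra_simps)

lemma unstraighten_zero: "unstraighten 0 0 0 = 0"
  by (simp add: unstraighten_def)

lemma unstraighten_nth:
  "unstraighten p q a $ 1 = p $ 1" "unstraighten p q a $ 2 = p $ 2" "unstraighten p q a $ 3 = p $ 3"
  "unstraighten p q a $ 4 = q $ 1" "unstraighten p q a $ 5 = q $ 2" "unstraighten p q a $ 6 = q $ 3"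
  "unstraighten p q a $ 7 = a" "unstraighten p q a $ 8 = 0"
  by (simp_all add: unstraighten_def e8_nth)

lemma straighten_unstraighten:
  "straighten u w 1 2 3 (unstraighten p q a) = p + a *\<^sub>R u"
  "straighten u w 4 5 6 (unstraighten p q a) = q + a *\<^sub>R u"
  by (simp_all add: straighten_def unstraighten_nth vec_eq_iff forall_3)

text \<open>By \<open>straighten_unstraighten\<close> the correction by \<open>d\<close> disappears
  as soon as a bracket is straightened again. Nested brackets thus become nested cross products, and
  the identity splits into Jacobi for \<open>cross3\<close> in each copy and an identity for the
  numbers \<open>d\<close>.\<close>

lemma lie_bracket_twisted_product: "lie_bracket (twisted_product_bracket u w u' w' \<rho>)"
  unfolding lie_bracket_def
proof (intro conjI allI)
  show "bilinear (twisted_product_bracket u w u' w' \<rho>)"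
    unfolding bilinear_def twisted_product_bracket_def Let_def
    by (intro conjI allI linearI)
      (simp_all add: straighten_add straighten_scaleR unstraighten_add unstraighten_scaleR
        cross_add_left cross_add_right cross_mult_left cross_mult_right algebra_simps)
  show "twisted_product_bracket u w u' w' \<rho> x x = 0" for x
    by (simp add: twisted_product_bracket_def unstraighten_zero)
  fix x y z
  have *: "cross3 a (2 *\<^sub>R b) = 2 *\<^sub>R cross3 a b" for a b by (simp add: cross_mult_right)
  have J: "cross3 a (cross3 b c) + cross3 b (cross3 c a) + cross3 c (cross3 a b) = 0" for a b c
    by (rule Jacobi)
  let ?P = "straighten u w 1 2 3" and ?Q = "straighten u' w' 4 5 6"
  show "twisted_product_bracket u w u' w' \<rho> x (twisted_product_bracket u w u' w' \<rho> y z) +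
     twisted_product_bracket u w u' w' \<rho> y (twisted_product_bracket u w u' w' \<rho> z x) +
     twisted_product_bracket u w u' w' \<rho> z (twisted_product_bracket u w u' w' \<rho> x y) = 0"
    using J[of "?P x" "?P y" "?P z"] J[of "?Q x" "?Q y" "?Q z"]
    by (simp add: twisted_product_bracket_def Let_def straighten_unstraighten unstraighten_add * unstraighten_nth
        unstraighten_zero algebra_simps flip: scaleR_add_right)
qed

text \<open>The first vector solves \<open>[U, X] = [U, u]\<close> on the first copy:
  \<open>[A, u]\<close> is \<open>2 A x u\<close> with coordinates
  \<open>(0, - 2 u_3, 2 u_2)\<close>, to be matched with \<open>(0, - b11, - c11)\<close>, and
  \<open>[B, X]\<close> gives \<open>u_1\<close>. The other three vectors arise in the same
  way.\<close>

lemma bracket_relations_twisted_product: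
  "bracket_relations (twisted_product_bracket
      (vector [c12 / 2, - c11 / 2, b11 / 2]) (vector [c22 / 2, - c21 / 2, b21 / 2])
      (vector [t15 / 2, - t14 / 2, s14 / 2]) (vector [t25 / 2, - t24 / 2, s24 / 2]) \<rho>)
    (e8 1) (e8 2) (e8 3) (e8 4) (e8 5) (e8 6) (e8 7) (e8 8)
    b11 b21 c11 c12 c21 c22 s14 s24 t14 t15 t24 t25 \<rho>"
  by (simp add: bracket_relations_def su2_su2_relations_def twisted_product_bracket_def vec8_eq_iff
      unstraighten_nth straighten_def e8_nth cross3_def field_simps)

text \<open>The relations list each pair of axes in one order; skew-symmetry supplies the other
  order and bilinearity the rest.\<close>

lemma bracket_relations_unique:
  fixes f g :: "real^8 \<Rightarrow> real^8 \<Rightarrow> real^8"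
  assumes f: "lie_bracket f" "bracket_relations f (e8 1) (e8 2) (e8 3) (e8 4) (e8 5) (e8 6) (e8 7) (e8 8)
      b11 b21 c11 c12 c21 c22 s14 s24 t14 t15 t24 t25 \<rho>"
    and g: "lie_bracket g" "bracket_relations g (e8 1) (e8 2) (e8 3) (e8 4) (e8 5) (e8 6) (e8 7) (e8 8)
      b11 b21 c11 c12 c21 c22 s14 s24 t14 t15 t24 t25 \<rho>"
  shows "f = g"
proof (rule bilinear_eq_stdbasis[OF lie_bracket_bilinear[OF f(1)] lie_bracket_bilinear[OF g(1)]])
  have skew: "f y x = g y x" if "f x y = g x y" for x y
    using that lie_bracket_skew[OF f(1), of y x] lie_bracket_skew[OF g(1), of y x] by simp
  have self: "f x x = g x x" for x
    by (simp add: lie_bracket_self[OF f(1)] lie_bracket_self[OF g(1)])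
  have rel: "su2_su2_relations f (e8 1) (e8 2) (e8 3) (e8 4) (e8 5) (e8 6)"
      "su2_su2_relations g (e8 1) (e8 2) (e8 3) (e8 4) (e8 5) (e8 6)"
    using f(2) g(2) by (simp_all add: bracket_relations_def)
  have tab: "f (e8 i) (e8 j) = g (e8 i) (e8 j)" if "i \<in> {1,2,3,4,5,6}" "j \<in> {1,2,3,4,5,6}" for i j
    using that
    by (auto simp: su2_su2_bracket_table[OF f(1) rel(1)] su2_su2_bracket_table[OF g(1) rel(2)] self)
  have X: "f (e8 i) (e8 7) = g (e8 i) (e8 7)" "f (e8 i) (e8 8) = g (e8 i) (e8 8)" if "i \<in> {1,2,3,4,5,6}" for i
    using that f(2) g(2) by (auto simp: bracket_relations_def)
  have Y: "f (e8 7) (e8 8) = g (e8 7) (e8 8)" using f(2) g(2) by (simp add: bracket_relations_def)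
  have all: "f (e8 i) (e8 j) = g (e8 i) (e8 j)" for i j
    using exhaust_8[of i] exhaust_8[of j] tab[of i j] X[of i] X[of j, THEN skew] Y Y[THEN skew] self[of "e8 i"]
    by auto
  show "f i j = g i j" if "i \<in> Basis" "j \<in> Basis" for i j
    using that all by (auto simp: Basis_vec_def)
qed

section \<open>Adapted orthonormal frames\<close>

text \<open>A Gram-Schmidt step for the form \<open>ip\<close>, which need not be the inner product
  of the type. Counting gives a vector outside the span, so its residual is nonzero and can be
  normalized.\<close>

lemma orthonormal_extend:
  fixes ip :: "'a::euclidean_space \<Rightarrow> 'a \<Rightarrow> real"
  assumes bil: "bilinear ip" and pos: "\<And>x. x \<noteq> 0 \<Longrightarrow> ip x x > 0"
    and F: "finite F" "card F < DIM('a)" "\<And>x y. x \<in> F \<Longrightarrow> y \<in> F \<Longrightarrow> ip x y = (if x = y then 1 else 0)"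
  shows "\<exists>z. ip z z = 1 \<and> (\<forall>x\<in>F. ip z x = 0)"
proof -
  have "span F \<noteq> UNIV"
    using dim_le_card[of UNIV F] F(1,2) by auto
  then obtain z where z: "z \<notin> span F" by blast
  define y where "y = z - (\<Sum>x\<in>F. ip z x *\<^sub>R x)"
  have y: "y \<noteq> 0"
    using z span_sum[of F "\<lambda>x. ip z x *\<^sub>R x" F] by (auto simp: y_def span_base span_scale)
  have orth: "ip y x = 0" if x: "x \<in> F" for x
  proof -
    have lin: "linear (\<lambda>v. ip v x)" using bil by (simp add: bilinear_def)
    have "ip (\<Sum>u\<in>F. ip z u *\<^sub>R u) x = (\<Sum>u\<in>F. ip z u * ip u x)"
      by (simp add: linear_sum[OF lin] linear_scale[OF lin])
    also have "\<dots> = (\<Sum>u\<in>F. if u = x then ip z u else 0)"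
      by (rule sum.cong) (simp_all add: F(3) x)
    also have "\<dots> = ip z x" using F(1) x by simp
    finally show ?thesis by (simp add: y_def linear_diff[OF lin])
  qed
  have "ip y y > 0" using pos y by blast
  then show ?thesis
    using orth by (intro exI[of _ "(1 / sqrt (ip y y)) *\<^sub>R y"])
      (simp add: bilinear_lmul[OF bil] bilinear_rmul[OF bil])
qed

text \<open>Two orthonormal extensions give a basis of \<open>m\<close>, which is then rotated. The
  map \<open>L\<close> onto the resulting frame is isometric, hence injective, hence bijective by
  dimension.\<close>

lemma adapted_frame:
  fixes br :: "'a::euclidean_space \<Rightarrow> 'a \<Rightarrow> 'a" and ip :: "'a \<Rightarrow> 'a \<Rightarrow> real"
  assumes dim: "DIM('a) = 8" and br: "lie_bracket br"
    and bil: "bilinear ip" and sym: "\<And>x y. ip x y = ip y x" and pos: "\<And>x. x \<noteq> 0 \<Longrightarrow> ip x x > 0"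
    and fs: "length fs = 6" "\<And>i j. i < 6 \<Longrightarrow> j < 6 \<Longrightarrow> ip (fs ! i) (fs ! j) = (if i = j then 1 else 0)"
  shows "\<exists>L :: real^8 \<Rightarrow> 'a. linear L \<and> bij L \<and> (\<forall>x y. ip (L x) (L y) = x \<bullet> y) \<and>
    map (\<lambda>i. L (e8 i)) [1, 2, 3, 4, 5, 6] = fs \<and> ip (br (L (e8 7)) (L (e8 8))) (L (e8 8)) = 0"
proof -
  have on: "ip x y = (if x = y then 1 else 0)" if "x \<in> set fs" "y \<in> set fs" for x y
  proof -
    obtain i j where "i < 6" "j < 6" "x = fs ! i" "y = fs ! j"
      using \<open>x \<in> set fs\<close> \<open>y \<in> set fs\<close> fs(1) by (auto simp: in_set_conv_nth)
    then show ?thesis using fs(2)[of i j] fs(2)[of i i] by (auto split: if_splits)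
  qed
  obtain x0 where x0: "ip x0 x0 = 1" "\<forall>f\<in>set fs. ip x0 f = 0"
    using orthonormal_extend[OF bil pos, of "set fs"] card_length[of fs] dim fs(1) on by auto
  have card: "card (insert x0 (set fs)) < DIM('a)"
    using card_length[of fs] dim fs(1) card_insert_le_m1[of 7 "set fs" x0] by simp
  \<comment> \<open>Unit length and orthogonality to \<open>fs\<close> force \<open>x0\<close>
    outside \<open>set fs\<close>, so the enlarged set is still orthonormal.\<close>
  have on0: "ip x y = (if x = y then 1 else 0)" if "x \<in> insert x0 (set fs)" "y \<in> insert x0 (set fs)" for x y
    using that on x0 sym by (metis insert_iff zero_neq_one)
  obtain y0 where y0: "ip y0 y0 = 1" "\<forall>f\<in>insert x0 (set fs). ip y0 f = 0"
    using orthonormal_extend[OF bil pos _ card on0] by auto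
  define \<alpha> where "\<alpha> = ip (br x0 y0) x0"
  define \<beta> where "\<beta> = ip (br x0 y0) y0"
  \<comment> \<open>The rotation turns \<open>x0\<close> into the direction
    \<open>(\<alpha>, \<beta>)\<close> of the m-component of \<open>br x0 y0\<close>; the second
    equation says that the component along the rotated \<open>y0\<close> vanishes. If that direction
    is undefined, the identity rotation serves.\<close>
  obtain c s where cs: "c * c + s * s = 1" "c * \<beta> = s * \<alpha>"
  proof (cases "\<alpha> = 0 \<and> \<beta> = 0")
    case True then show thesis using that[of 1 0] by simp
  next
    case False
    then have "\<alpha> * \<alpha> + \<beta> * \<beta> > 0" by (metis add_nonneg_pos add_pos_nonneg not_real_square_gt_zero zero_le_square)
    then have r: "sqrt (\<alpha> * \<alpha> + \<beta> * \<beta>) * sqrt (\<alpha> * \<alpha> + \<beta> * \<beta>) = \<alpha> * \<alpha> + \<beta> * \<beta>"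
        "\<alpha> * \<alpha> + \<beta> * \<beta> \<noteq> 0"
      by (simp, linarith)
    let ?c = "\<alpha> / sqrt (\<alpha> * \<alpha> + \<beta> * \<beta>)" and ?s = "\<beta> / sqrt (\<alpha> * \<alpha> + \<beta> * \<beta>)"
    have "?c * ?c + ?s * ?s = 1"
      using r(2) by (simp only: times_divide_times_eq r(1) flip: add_divide_distrib) simp
    moreover have "?c * \<beta> = ?s * \<alpha>" by simp
    ultimately show thesis by (rule that)
  qed
  define X where "X = c *\<^sub>R x0 + s *\<^sub>R y0"
  define Y where "Y = c *\<^sub>R y0 - s *\<^sub>R x0"
  have ip0: "ip x0 x0 = 1" "ip y0 y0 = 1" "ip x0 y0 = 0" "ip y0 x0 = 0"
    using x0 y0 sym[of x0 y0] by auto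
  \<comment> \<open>The factor is the determinant of the rotation, so the bracket, and with it
    \<open>\<alpha>\<close> and \<open>\<beta>\<close>, stays the same.\<close>
  have "br X Y = (c * c + s * s) *\<^sub>R br x0 y0"
    using lie_bracket_skew[OF br, of y0 x0]
    by (simp add: X_def Y_def bilinear_simps[OF lie_bracket_bilinear[OF br]] lie_bracket_self[OF br] algebra_simps)
  then have "br X Y = br x0 y0" using cs by simp
  then have brY: "ip (br X Y) Y = 0"
    using cs by (simp add: Y_def bilinear_simps[OF bil] flip: \<alpha>_def \<beta>_def)
  have ipXY: "ip X X = 1" "ip Y Y = 1" "ip X Y = 0" "ip Y X = 0"
    using cs by (simp_all add: X_def Y_def bilinear_simps[OF bil] ip0 algebra_simps)
  have ipf: "ip X f = 0" "ip Y f = 0" "ip f X = 0" "ip f Y = 0" if "f \<in> set fs" for f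
    using that x0 y0 sym[of f X] sym[of f Y] by (auto simp: X_def Y_def bilinear_simps[OF bil])
  obtain a1 a2 a3 a4 a5 a6 where fs6: "fs = [a1, a2, a3, a4, a5, a6]"
    using fs(1) by (auto simp: eval_nat_numeral length_Suc_conv)
  have ipa: "ip a1 a1 = 1" "ip a2 a2 = 1" "ip a3 a3 = 1" "ip a4 a4 = 1" "ip a5 a5 = 1" "ip a6 a6 = 1"
    "ip a1 a2 = 0" "ip a1 a3 = 0" "ip a1 a4 = 0" "ip a1 a5 = 0" "ip a1 a6 = 0"
    "ip a2 a3 = 0" "ip a2 a4 = 0" "ip a2 a5 = 0" "ip a2 a6 = 0"
    "ip a3 a4 = 0" "ip a3 a5 = 0" "ip a3 a6 = 0" "ip a4 a5 = 0" "ip a4 a6 = 0" "ip a5 a6 = 0"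
    using fs(2)[of 0 0] fs(2)[of 1 1] fs(2)[of 2 2] fs(2)[of 3 3] fs(2)[of 4 4] fs(2)[of 5 5]
      fs(2)[of 0 1] fs(2)[of 0 2] fs(2)[of 0 3] fs(2)[of 0 4] fs(2)[of 0 5]
      fs(2)[of 1 2] fs(2)[of 1 3] fs(2)[of 1 4] fs(2)[of 1 5]
      fs(2)[of 2 3] fs(2)[of 2 4] fs(2)[of 2 5] fs(2)[of 3 4] fs(2)[of 3 5] fs(2)[of 4 5]
    by (simp_all add: fs6)
  have ip_sym0: "ip y x = 0" if "ip x y = 0" for x y using that sym[of x y] by simp
  note ipa' = ipa(7-21)[THEN ip_sym0]
  define L :: "real^8 \<Rightarrow> 'a" where "L = (\<lambda>v. v$1 *\<^sub>R a1 + v$2 *\<^sub>R a2 + v$3 *\<^sub>R a3 + v$4 *\<^sub>R a4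
    + v$5 *\<^sub>R a5 + v$6 *\<^sub>R a6 + v$7 *\<^sub>R X + v$8 *\<^sub>R Y)"
  have L: "linear L" by (rule linearI) (simp_all add: L_def algebra_simps)
  have Le: "L (e8 1) = a1" "L (e8 2) = a2" "L (e8 3) = a3" "L (e8 4) = a4" "L (e8 5) = a5"
      "L (e8 6) = a6" "L (e8 7) = X" "L (e8 8) = Y"
    by (simp_all add: L_def e8_nth)
  have linL: "linear (\<lambda>y. ip a (L y))" "linear (\<lambda>x. ip (L x) a)" for a
    using bil linear_compose[OF L] by (auto simp: bilinear_def comp_def)
  have col: "ip (L (e8 1)) (L y) = y$1" "ip (L (e8 2)) (L y) = y$2" "ip (L (e8 3)) (L y) = y$3"
      "ip (L (e8 4)) (L y) = y$4" "ip (L (e8 5)) (L y) = y$5" "ip (L (e8 6)) (L y) = y$6"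
      "ip (L (e8 7)) (L y) = y$7" "ip (L (e8 8)) (L y) = y$8" for y
    by (subst linear_expansion_8[OF linL(1)], simp add: Le ipa ipa' ipXY ipf fs6)+
  have iso: "ip (L x) (L y) = x \<bullet> y" for x y
    by (subst linear_expansion_8[OF linL(2)]) (simp add: col inner_vec_def sum_8)
  have "inj L"
    unfolding linear_injective_0[OF L] by (metis bilinear_lzero[OF bil] inner_eq_zero_iff iso)
  moreover have "surj L"
    by (rule linear_injective_imp_surjective[OF L \<open>inj L\<close>]) (simp add: dim)
  ultimately show ?thesis
    using L iso brY by (intro exI[of _ L]) (auto simp: bij_def Le fs6)
qed

section \<open>Transport of brackets and metrics along linear maps\<close>

text \<open>The laws are assumed only on the range of \<open>E\<close>, because
  \<open>field_bracket\<close> obeys them only for smooth fields. Injectivity of \<open>E\<close>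
  carries them over to a bracket that obeys them on its whole type.\<close>

lemma lie_bracket_pullback:
  fixes E :: "'a::real_vector \<Rightarrow> 'v::real_vector"
  assumes E: "linear E" "inj E"
    and closed: "\<And>x y. br (E x) (E y) \<in> range E"
    and add: "\<And>x y z. br (E x + E y) (E z) = br (E x) (E z) + br (E y) (E z)"
    and scale: "\<And>c x z. br (c *\<^sub>R E x) (E z) = c *\<^sub>R br (E x) (E z)"
    and skew: "\<And>x y. br (E x) (E y) = - br (E y) (E x)"
    and jacobi: "\<And>x y z. br (E x) (br (E y) (E z)) + br (E y) (br (E z) (E x)) + br (E z) (br (E x) (E y)) = 0"
  obtains br' where "lie_bracket br'" "\<And>x y. E (br' x y) = br (E x) (E y)"
proof
  define br' where "br' = (\<lambda>x y. inv_into UNIV E (br (E x) (E y)))"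
  show br': "E (br' x y) = br (E x) (E y)" for x y
    using closed by (simp add: br'_def f_inv_into_f)
  have eqI: "x = y" if "E x = E y" for x y using E(2) that by (simp add: inj_eq)
  have sk: "br' x y = - br' y x" for x y
    by (rule eqI) (simp add: br' linear_neg[OF E(1)] skew[of x y])
  have l: "br' (x + y) z = br' x z + br' y z" "br' (c *\<^sub>R x) z = c *\<^sub>R br' x z" for x y z c
    by (rule eqI; simp add: br' linear_add[OF E(1)] linear_scale[OF E(1)] add scale)+
  have r: "br' z (x + y) = br' z x + br' z y" "br' z (c *\<^sub>R x) = c *\<^sub>R br' z x" for x y z c
    using sk[of z "x + y"] sk[of z "c *\<^sub>R x"] sk[of z x] sk[of z y] by (simp_all add: l)
  have "br' x x = 0" for x
  proof -
    have "br' x x + br' x x = 0" using sk[of x x] by (metis add.right_inverse)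
    then show ?thesis by (simp flip: scaleR_2)
  qed
  moreover have "br' x (br' y z) + br' y (br' z x) + br' z (br' x y) = 0" for x y z
    by (rule eqI) (simp add: br' linear_add[OF E(1)] linear_0[OF E(1)] jacobi)
  moreover have "bilinear br'"
    unfolding bilinear_def by (intro conjI allI linearI) (simp_all add: l r)
  ultimately show "lie_bracket br'" by (simp add: lie_bracket_def)
qed

text \<open>An equivalence because it is used in both directions: to bring the given relations into
  coordinates and to return with the result.\<close>

lemma su2_su2_relations_linear_image:
  assumes E: "linear E" "inj E" "\<And>x y. E (br' x y) = br (E x) (E y)"
  shows "su2_su2_relations br (E a) (E b) (E c) (E r) (E s) (E t) \<longleftrightarrow> su2_su2_relations br' a b c r s t"
proof -
  have "E x = 0 \<longleftrightarrow> x = 0" for x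
    using inj_eq[OF E(2), of x 0] by (simp add: linear_0[OF E(1)])
  then show ?thesis
    by (simp add: su2_su2_relations_def inj_eq[OF E(2)] flip: E(3) linear_scale[OF E(1)])
qed

lemma bracket_relations_linear_image:
  assumes E: "linear E" "inj E" "\<And>x y. E (br' x y) = br (E x) (E y)"
    and rel: "bracket_relations br' a b c r s t x y b11 b21 c11 c12 c21 c22 s14 s24 t14 t15 t24 t25 \<rho>"
  shows "bracket_relations br (E a) (E b) (E c) (E r) (E s) (E t) (E x) (E y)
    b11 b21 c11 c12 c21 c22 s14 s24 t14 t15 t24 t25 \<rho>"
proof -
  note lin = linear_add[OF E(1)] linear_diff[OF E(1)] linear_neg[OF E(1)] linear_scale[OF E(1)]
  have "su2_su2_relations br (E a) (E b) (E c) (E r) (E s) (E t)"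
    by (rule su2_su2_relations_linear_image[of E br' br, OF E, THEN iffD2])
      (use rel in \<open>unfold bracket_relations_def, blast\<close>)
  then show ?thesis
    using rel by (simp only: bracket_relations_def E(3)[symmetric] lin simp_thms)
qed

text \<open>The metric is constrained only on tangent vectors, so membership in the Lie algebra is
  required throughout. For definiteness, a left-invariant field that vanishes at the identity
  vanishes everywhere.\<close>

lemma (in lie_group) metric_inner_lie_algebra:
  assumes g: "riemannian_metric At g"
    and X: "X \<in> lie_algebra G At" and Y: "Y \<in> lie_algebra G At" and Z: "Z \<in> lie_algebra G At"
  shows "metric_inner G g (X + Y) Z = metric_inner G g X Z + metric_inner G g Y Z"
    and "metric_inner G g (c *\<^sub>R X) Z = c * metric_inner G g X Z"
    and "metric_inner G g X Y = metric_inner G g Y X"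
    and "X \<noteq> 0 \<Longrightarrow> metric_inner G g X X > 0"
proof -
  let ?e = "\<one>\<^bsub>G\<^esub>"
  have t: "X ?e \<in> tangent_space At ?e" "Y ?e \<in> tangent_space At ?e" "Z ?e \<in> tangent_space At ?e"
    using X Y Z smooth_vf_tangent lie_algebra_smooth by blast+
  have g': "g ?e (u + v) w = g ?e u w + g ?e v w \<and> g ?e (c *\<^sub>R u) w = c * g ?e u w \<and>
      g ?e u v = g ?e v u \<and> (u \<noteq> 0 \<longrightarrow> g ?e u u > 0)"
    if "u \<in> tangent_space At ?e" "v \<in> tangent_space At ?e" "w \<in> tangent_space At ?e" for u v w c
    using g that unfolding riemannian_metric_def by blast
  show "metric_inner G g (X + Y) Z = metric_inner G g X Z + metric_inner G g Y Z"
    using g'[OF t] by (simp add: metric_inner_def)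
  show "metric_inner G g (c *\<^sub>R X) Z = c * metric_inner G g X Z"
    using g'[OF t] by (simp add: metric_inner_def scaleR_fun_def[of c X])
  show "metric_inner G g X Y = metric_inner G g Y X"
    using g'[OF t] by (simp add: metric_inner_def)
  assume "X \<noteq> 0"
  have "X ?e \<noteq> 0"
  proof
    assume "X ?e = 0"
    have "X = 0"
    proof
      fix a
      show "X a = 0 a"
        using lie_algebra_left_push[OF X, of a ?e] \<open>X ?e = 0\<close>
        by (simp add: mult_one left_push_def fun_eq_iff)
    qed
    then show False using \<open>X \<noteq> 0\<close> by blast
  qed
  then show "metric_inner G g X X > 0" using g'[OF t] by (simp add: metric_inner_def)
qed

text \<open>The isometric model on \<open>real^8\<close>: \<open>F\<close> is composed of the
  parametrization of left-invariant fields by \<open>'a\<close> and the adapted frame of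
  \<open>'a\<close> for the pulled-back metric.\<close>

lemma (in lie_group) lie_algebra_model:
  assumes "DIM('a) = 8" and g: "left_invariant_metric G At g"
    and on: "orthonormal_basis (metric_inner G g) [A, B, C, R, S, T] V" and V: "V \<subseteq> lie_algebra G At"
  obtains F :: "real^8 \<Rightarrow> 'g vector_field" and br where
    "linear F" "inj F" "range F = lie_algebra G At" "lie_bracket br"
    "\<And>x y. F (br x y) = field_bracket At (F x) (F y)"
    "\<And>x y. metric_inner G g (F x) (F y) = x \<bullet> y"
    "map (\<lambda>i. F (e8 i)) [1, 2, 3, 4, 5, 6] = [A, B, C, R, S, T]"
    "br (e8 7) (e8 8) $ 8 = 0"
proof -
  have g: "riemannian_metric At g" using g by (simp add: left_invariant_metric_def)
  obtain E :: "'a \<Rightarrow> 'g vector_field" where E: "linear E" "inj E" and rE: "range E = lie_algebra G At"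
    using lie_algebra_parametrization by blast
  have lie: "E x \<in> lie_algebra G At" for x using rE by blast
  note sm = lie_algebra_smooth[OF lie]
  obtain br1 where br1: "lie_bracket br1" "\<And>x y. E (br1 x y) = field_bracket At (E x) (E y)"
  proof (rule lie_bracket_pullback[OF E, of "field_bracket At"])
    show "field_bracket At (E x) (E y) \<in> range E" for x y
      unfolding rE by (rule lie_algebra_field_bracket[OF lie lie])
  qed (use field_bracket_add_left[OF sm sm sm] field_bracket_scaleR_left[OF sm sm] field_bracket_skew
      field_bracket_jacobi[OF sm sm sm] in blast)+
  define ip where "ip = (\<lambda>x y. metric_inner G g (E x) (E y))"
  note mi = metric_inner_lie_algebra[OF g lie lie lie]
  have ip_sym: "ip x y = ip y x" for x y unfolding ip_def by (rule mi(3))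
  have "linear (\<lambda>x. ip x y)" for y
    by (rule linearI) (simp_all add: ip_def linear_add[OF E(1)] linear_scale[OF E(1)] mi(1,2))
  moreover from this have "linear (\<lambda>y. ip x y)" for x
    by (subst ip_sym)
  ultimately have bil: "bilinear ip" by (simp add: bilinear_def)
  have pos: "ip x x > 0" if "x \<noteq> 0" for x
    unfolding ip_def
    by (rule mi(4)) (use that E in \<open>metis linear_injective_0\<close>)
  have "set [A, B, C, R, S, T] \<subseteq> range E"
    using on V span_superset[of "set [A, B, C, R, S, T]"] unfolding orthonormal_basis_def rE by blast
  then have "\<exists>fs. [A, B, C, R, S, T] = map E fs"
    unfolding ex_map_conv by blast
  then obtain fs where fs: "map E fs = [A, B, C, R, S, T]" by (elim exE) (erule that[OF sym])
  have len: "length fs = 6" using arg_cong[OF fs, of length] by simp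
  have onf: "ip (fs ! i) (fs ! j) = (if i = j then 1 else 0)" if "i < 6" "j < 6" for i j
  proof -
    have "E (fs ! i) = [A, B, C, R, S, T] ! i" "E (fs ! j) = [A, B, C, R, S, T] ! j"
      using that len by (simp_all flip: fs)
    then show ?thesis using on that by (simp add: orthonormal_basis_def ip_def)
  qed
  obtain L :: "real^8 \<Rightarrow> 'a" where L: "linear L" "bij L" "\<And>x y. ip (L x) (L y) = x \<bullet> y"
      and Lfs: "map (\<lambda>i. L (e8 i)) [1, 2, 3, 4, 5, 6] = fs" and L8: "ip (br1 (L (e8 7)) (L (e8 8))) (L (e8 8)) = 0"
    using adapted_frame[OF assms(1) br1(1) bil ip_sym pos len onf] by blast
  note b1 = lie_bracket_bilinear[OF br1(1)]
  obtain br where br: "lie_bracket br" "\<And>x y. L (br x y) = br1 (L x) (L y)"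
  proof (rule lie_bracket_pullback[OF L(1) bij_is_inj[OF L(2)], of br1])
    show "br1 (L x) (L y) \<in> range L" for x y using L(2) by (simp add: bij_is_surj)
  qed (use bilinear_ladd[OF b1] bilinear_lmul[OF b1] lie_bracket_skew[OF br1(1)]
      lie_bracket_jacobi[OF br1(1)] in blast)+
  show thesis
  proof (rule that[of "E \<circ> L" br])
    show "linear (E \<circ> L)" using linear_compose[OF L(1) E(1)] .
    show "inj (E \<circ> L)" using E(2) L(2) by (simp add: bij_is_inj inj_compose)
    show "range (E \<circ> L) = lie_algebra G At"
      using rE bij_is_surj[OF L(2)] by (simp flip: image_image add: image_comp[symmetric])
    show "lie_bracket br" by (rule br(1))
    show "(E \<circ> L) (br x y) = field_bracket At ((E \<circ> L) x) ((E \<circ> L) y)" for x y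
      by (simp add: br br1)
    show "metric_inner G g ((E \<circ> L) x) ((E \<circ> L) y) = x \<bullet> y" for x y
      using L(3) by (simp add: ip_def)
    show "map (\<lambda>i. (E \<circ> L) (e8 i)) [1, 2, 3, 4, 5, 6] = [A, B, C, R, S, T]"
      using fs by (simp flip: Lfs)
    have "br (e8 7) (e8 8) \<bullet> e8 8 = 0" using L8 by (simp add: L(3) flip: br(2))
    then show "br (e8 7) (e8 8) $ 8 = 0" by (simp add: inner_axis)
  qed
qed

text \<open>In \<open>real^8\<close> the last two axes visibly span the complement of the first six,
  and the isometry \<open>F\<close> carries this over.\<close>

lemma orthonormal_basis_orth_complement:
  fixes F :: "real^8 \<Rightarrow> 'v::real_vector"
  assumes F: "linear F" and iso: "\<And>x y. ip (F x) (F y) = x \<bullet> y"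
  shows "orthonormal_basis ip [F (e8 7), F (e8 8)]
    (orth_complement ip (range F) (span (F ` {e8 1, e8 2, e8 3, e8 4, e8 5, e8 6})))"
proof -
  let ?K = "{e8 1, e8 2, e8 3, e8 4, e8 5, e8 6}"
  have K: "w $ 7 = 0 \<and> w $ 8 = 0" if "w \<in> span ?K" for w
    using that by (induction rule: span_induct_alt) (auto simp: e8_nth)
  have spK: "span (F ` ?K) = F ` span ?K" and spXY: "span {F (e8 7), F (e8 8)} = F ` span {e8 7, e8 8}"
    using linear_span_image[OF F, of ?K] linear_span_image[OF F, of "{e8 7, e8 8}"] by simp_all
  have "span {e8 7, e8 8} = {v. \<forall>u\<in>span ?K. v \<bullet> u = 0}"
  proof (intro equalityI subsetI)
    fix v assume "v \<in> span {e8 7, e8 8}"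
    then have "v $ 1 = 0 \<and> v $ 2 = 0 \<and> v $ 3 = 0 \<and> v $ 4 = 0 \<and> v $ 5 = 0 \<and> v $ 6 = 0"
      by (induction rule: span_induct_alt) (auto simp: e8_nth)
    then show "v \<in> {v. \<forall>u\<in>span ?K. v \<bullet> u = 0}"
      using K by (auto simp: inner_vec_def sum_8)
  next
    fix v assume "v \<in> {v. \<forall>u\<in>span ?K. v \<bullet> u = 0}"
    then have "\<forall>u\<in>?K. v \<bullet> u = 0" by (simp add: span_base)
    then have "v = v $ 7 *\<^sub>R e8 7 + v $ 8 *\<^sub>R e8 8"
      by (simp add: vec8_eq_iff e8_nth inner_axis)
    then show "v \<in> span {e8 7, e8 8}"
      by (metis insertCI span_add span_base span_scale)
  qed
  then have "span {F (e8 7), F (e8 8)} = orth_complement ip (range F) (span (F ` ?K))"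
    unfolding spK spXY orth_complement_def by (auto simp: iso)
  moreover have "ip ([F (e8 7), F (e8 8)] ! i) ([F (e8 7), F (e8 8)] ! j) = (if i = j then 1 else 0)"
    if "i < 2" "j < 2" for i j
    using that by (auto simp: less_2_cases_iff iso inner_axis e8_nth)
  ultimately show ?thesis by (simp add: orthonormal_basis_def)
qed

theorem proposition4p1:
  fixes G :: "'g::{t2_space, second_countable_topology} monoid"
    and At :: "('g, 'a::euclidean_space) chart set"
    and g :: "'g \<Rightarrow> 'g tangent_vector \<Rightarrow> 'g tangent_vector \<Rightarrow> real"
    and K :: "'g set"
    and \<iota> :: "(complex^2^2) \<times> (complex^2^2) \<Rightarrow> 'g"
    and A B C R S T :: "'g vector_field"
  assumes G: "lie_group G At"
    and dim_G: "DIM('a) = 8"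
    and g: "left_invariant_metric G At g"
    and K: "SU2_SU2_subgroup G K \<iota>"
    and k_basis: "orthonormal_basis (metric_inner G g) [A, B, C, R, S, T]
        (subgroup_lie_algebra G At K)"
    and first_copy: "span {A, B, C} = subgroup_lie_algebra G At (\<iota> ` (carrier SU2 \<times> {mat 1}))"
    and second_copy: "span {R, S, T} = subgroup_lie_algebra G At (\<iota> ` ({mat 1} \<times> carrier SU2))"
    and k_relations: "su2_su2_relations (field_bracket At) A B C R S T"
  shows "(\<exists>X Y. orthonormal_basis (metric_inner G g) [X, Y]
              (orth_complement (metric_inner G g) (lie_algebra G At) (subgroup_lie_algebra G At K)) \<and>
            (\<exists>b11 b21 c11 c12 c21 c22 s14 s24 t14 t15 t24 t25 \<rho>.
              bracket_relations (field_bracket At) A B C R S T X Y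
                b11 b21 c11 c12 c21 c22 s14 s24 t14 t15 t24 t25 \<rho>)) \<and>
         (\<forall>b11 b21 c11 c12 c21 c22 s14 s24 t14 t15 t24 t25 \<rho>.
            \<exists>!br :: real^8 \<Rightarrow> real^8 \<Rightarrow> real^8. lie_bracket br \<and>
              bracket_relations br (axis 1 1) (axis 2 1) (axis 3 1) (axis 4 1) (axis 5 1)
                (axis 6 1) (axis 7 1) (axis 8 1)
                b11 b21 c11 c12 c21 c22 s14 s24 t14 t15 t24 t25 \<rho>)"
proof (intro conjI allI)
  interpret lie_group G At by (rule G)
  let ?ip = "metric_inner G g" and ?K = "subgroup_lie_algebra G At K"
  have "?K \<subseteq> lie_algebra G At" by (auto simp: subgroup_lie_algebra_def)
  then obtain F :: "real^8 \<Rightarrow> 'g vector_field" and br where F: "linear F" "inj F" "range F = lie_algebra G At"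
      and br: "lie_bracket br" "\<And>x y. F (br x y) = field_bracket At (F x) (F y)"
      and iso: "\<And>x y. ?ip (F x) (F y) = x \<bullet> y"
      and e: "map (\<lambda>i. F (e8 i)) [1, 2, 3, 4, 5, 6] = [A, B, C, R, S, T]"
      and z8: "br (e8 7) (e8 8) $ 8 = 0"
    using lie_algebra_model[OF dim_G g k_basis] by blast
  have e: "A = F (e8 1)" "B = F (e8 2)" "C = F (e8 3)" "R = F (e8 4)" "S = F (e8 5)" "T = F (e8 6)"
    using e by simp_all
  have "su2_su2_relations br (e8 1) (e8 2) (e8 3) (e8 4) (e8 5) (e8 6)"
    by (rule su2_su2_relations_linear_image[of F br "field_bracket At", OF F(1,2) br(2), THEN iffD1])
      (use k_relations in \<open>simp add: e\<close>)
  then obtain b11 b21 c11 c12 c21 c22 s14 s24 t14 t15 t24 t25 \<rho> where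
    "bracket_relations br (e8 1) (e8 2) (e8 3) (e8 4) (e8 5) (e8 6) (e8 7) (e8 8)
      b11 b21 c11 c12 c21 c22 s14 s24 t14 t15 t24 t25 \<rho>"
    using bracket_relations_adapted[OF br(1) _ z8] by blast
  from bracket_relations_linear_image[of F br "field_bracket At", OF F(1,2) br(2) this]
  have "bracket_relations (field_bracket At) A B C R S T (F (e8 7)) (F (e8 8))
      b11 b21 c11 c12 c21 c22 s14 s24 t14 t15 t24 t25 \<rho>"
    by (simp only: e)
  moreover have "?K = span (F ` {e8 1, e8 2, e8 3, e8 4, e8 5, e8 6})"
    using k_basis by (simp add: orthonormal_basis_def e)
  then have "orthonormal_basis ?ip [F (e8 7), F (e8 8)] (orth_complement ?ip (lie_algebra G At) ?K)"
    using orthonormal_basis_orth_complement[of F ?ip, OF F(1) iso] F(3) by simp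
  ultimately show "\<exists>X Y. orthonormal_basis ?ip [X, Y] (orth_complement ?ip (lie_algebra G At) ?K) \<and>
      (\<exists>b11 b21 c11 c12 c21 c22 s14 s24 t14 t15 t24 t25 \<rho>.
        bracket_relations (field_bracket At) A B C R S T X Y
          b11 b21 c11 c12 c21 c22 s14 s24 t14 t15 t24 t25 \<rho>)"
    by blast
next
  fix b11 b21 c11 c12 c21 c22 s14 s24 t14 t15 t24 t25 \<rho> :: real
  let ?br = "twisted_product_bracket
      (vector [c12 / 2, - c11 / 2, b11 / 2]) (vector [c22 / 2, - c21 / 2, b21 / 2])
      (vector [t15 / 2, - t14 / 2, s14 / 2]) (vector [t25 / 2, - t24 / 2, s24 / 2]) \<rho>"
  \<comment> \<open>Stated on \<open>real^8\<close> with the axes as basis, so that the relations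
    become structure constants of an abstract Lie algebra.\<close>
  show "\<exists>!br :: real^8 \<Rightarrow> real^8 \<Rightarrow> real^8. lie_bracket br \<and>
      bracket_relations br (e8 1) (e8 2) (e8 3) (e8 4) (e8 5) (e8 6) (e8 7) (e8 8)
        b11 b21 c11 c12 c21 c22 s14 s24 t14 t15 t24 t25 \<rho>"
  proof (rule ex1I)
    show "lie_bracket ?br \<and>
      bracket_relations ?br (e8 1) (e8 2) (e8 3) (e8 4) (e8 5) (e8 6) (e8 7) (e8 8)
        b11 b21 c11 c12 c21 c22 s14 s24 t14 t15 t24 t25 \<rho>"
      using lie_bracket_twisted_product bracket_relations_twisted_product by blast
  qed (elim conjE, rule bracket_relations_unique[OF _ _ lie_bracket_twisted_product bracket_relations_twisted_product])
qed

end
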